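(* Let $n\ge 3$, $t$ and $m$ be integers with $1\le t\le n-2$ and $n+\binom{t}{2}\le m\le n+\binom{t+1}{2}-1$. Then every connected graph $G$ with $n$ vertices and $m$ edges satisfies $mvc(G)\ge t+2$. This bound is sharp (i.e. some connected graph with $n$ vertices and $m$ edges has $mvc=t+2$) except when $m=n+\binom{t+1}{2}-1$ and $t\in\{n-3,n-4\}$. In these two exceptional cases, every connected graph $G$ with $n$ vertices and $m$ edges satisfies $mvc(G)\ge t+3$, and this bound is sharp (i.e. some connected graph with $n$ vertices and $m$ edges has $mvc=t+3$).
   Context: All graphs are simple, finite, undirected and connected. A path in a vertex-colored graph is vertex-monochromatic if all its internal vertices have the same color (in particular, a path with at most one internal vertex is vertex-monochromatic). A vertex-coloring (not required to be proper) of a connected graph $G$ is an MVC-coloring if any two vertices of $G$ are joined by a vertex-monochromatic path. The monochromatic vertex-connection number $mvc(G)$ is the maximum number of colors used in an MVC-coloring of $G$. By convention $\binom{1}{2}=0$. *)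

theory Defs
  imports Complex_Main
begin

definition simple_graph :: "'a set \<Rightarrow> 'a set set \<Rightarrow> bool" where
  "simple_graph V E \<longleftrightarrow> finite V \<and> (\<forall>e\<in>E. e \<subseteq> V \<and> card e = 2)"

text \<open>Paths are nonempty lists of distinct vertices; \<open>[u]\<close> is the trivial path from \<open>u\<close> to \<open>u\<close>.\<close>

definition path_between :: "'a set \<Rightarrow> 'a set set \<Rightarrow> 'a \<Rightarrow> 'a list \<Rightarrow> 'a \<Rightarrow> bool" where
  "path_between V E u p v \<longleftrightarrow>
     p \<noteq> [] \<and> hd p = u \<and> last p = v \<and> set p \<subseteq> V \<and> distinct p \<and>
     (\<forall>i. Suc i < length p \<longrightarrow> {p ! i, p ! Suc i} \<in> E)"

definition connected_graph :: "'a set \<Rightarrow> 'a set set \<Rightarrow> bool" where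
  "connected_graph V E \<longleftrightarrow>
     simple_graph V E \<and> V \<noteq> {} \<and> (\<forall>u\<in>V. \<forall>v\<in>V. \<exists>p. path_between V E u p v)"

definition internal_vertices :: "'a list \<Rightarrow> 'a set" where
  "internal_vertices p = set (butlast (tl p))"

definition vertex_monochromatic :: "('a \<Rightarrow> nat) \<Rightarrow> 'a list \<Rightarrow> bool" where
  "vertex_monochromatic c p \<longleftrightarrow>
     (\<forall>x\<in>internal_vertices p. \<forall>y\<in>internal_vertices p. c x = c y)"

definition MVC_coloring :: "'a set \<Rightarrow> 'a set set \<Rightarrow> ('a \<Rightarrow> nat) \<Rightarrow> bool" where
  "MVC_coloring V E c \<longleftrightarrow>
     (\<forall>u\<in>V. \<forall>v\<in>V. \<exists>p. path_between V E u p v \<and> vertex_monochromatic c p)"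

text \<open>For a connected graph the maximum is taken over a finite set (bounded by \<open>card V\<close>) that is
  nonempty (constant colorings qualify). For other graphs the value is not meaningful.\<close>

definition mvc :: "'a set \<Rightarrow> 'a set set \<Rightarrow> nat" where
  "mvc V E = Max {card (c ` V) | c. MVC_coloring V E c}"

end

theory Submission
  imports Defs
begin

text \<open>
  Lower bounds come from connected vertex sets. Let \<open>D\<close> be connected, with boundary \<open>N(D)\<close>. Adding to
  \<open>D\<close> a boundary vertex that has a neighbour outside \<open>D \<union> N(D)\<close> costs one boundary vertex and brings
  in at least one new one. So \<open>D\<close> grows to a connected dominating set \<open>D'\<close> whose complement is at
  least as large as \<open>N(D)\<close>. Giving one colour to \<open>D'\<close> and distinct further colours to all other
  vertices is an MVC-coloring, since any two vertices are joined through \<open>D'\<close>. Hence \<open>mvc\<close> exceeds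
  the size of every such boundary (\<open>mvc_gt_card_boundary\<close>).

  The core (\<open>exists_large_boundary\<close>) is that for \<open>n \<ge> t + 3\<close> and \<open>m \<ge> n + (t choose 2)\<close> some connected
  set has more than \<open>t\<close> boundary vertices; in the language of spanning trees, some spanning tree has
  more than \<open>t\<close> leaves. Suppose not. Start from a vertex \<open>x\<close> of maximum degree \<open>t - j\<close> and grow
  greedily, always adding a boundary vertex with as many outside neighbours as possible. The
  boundary can gain at most \<open>j\<close> vertices in total, and by the greedy choice no boundary vertex has
  more outside neighbours than the current gain plus one. This limits the number of edges among the
  vertices at distance at least two from \<open>x\<close> (\<open>growth_bound\<close>), and for \<open>j \<ge> 1\<close> the degree sum is then
  too small. For \<open>j = 0\<close> each neighbour of \<open>x\<close> has at most one neighbour farther away. Two neighbours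
  of \<open>x\<close> with different farther neighbours are nonadjacent or have a common non-neighbour in \<open>N(x)\<close>,
  for otherwise the two form a connected set with \<open>t + 1\<close> boundary vertices. So they are linked
  in the complement, and all but one of the edges leaving \<open>N(x)\<close> for farther vertices are paid for by missing
  edges inside \<open>N(x)\<close>. (If all these edges end in the same vertex, a similar argument applies to
  that vertex together with one of its neighbours in \<open>N(x)\<close>.)

  For \<open>n = t + 2\<close>, and in the exceptional cases, the graph is so dense that it has diameter at
  most two, where all vertices may get different colours, or a dominating edge. The latter
  follows again by comparing the edges at two vertices with the missing edges elsewhere.

  Sharpness uses three families: arbitrary connected graphs where \<open>mvc\<close> has to be \<open>n\<close>; graphs of
  large diameter, where a monochromatic path between far vertices already uses up many vertices;
  and, for the largest \<open>m\<close>, the complete graph on \<open>t + 2\<close> vertices with one edge replaced by a long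
  path. In the last two families, colours must agree because a path can leave a vertex
  set only through one of few vertices (\<open>path_crosses_boundary\<close>).
\<close>

section \<open>Paths and connected sets\<close>

definition connected_set :: "'a set set \<Rightarrow> 'a set \<Rightarrow> bool" where
  "connected_set E D \<longleftrightarrow> D \<noteq> {} \<and> (\<forall>u\<in>D. \<forall>v\<in>D. \<exists>p. path_between D E u p v)"

lemma path_between_refl: "u \<in> D \<Longrightarrow> path_between D E u [u] u"
  by (simp add: path_between_def)

lemma path_between_edge:
  "u \<in> D \<Longrightarrow> v \<in> D \<Longrightarrow> u \<noteq> v \<Longrightarrow> {u, v} \<in> E \<Longrightarrow> path_between D E u [u, v] v"
  by (simp add: path_between_def)

lemma path_between_mono:
  "path_between D E u p v \<Longrightarrow> D \<subseteq> D' \<Longrightarrow> path_between D' E u p v"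
  by (auto simp: path_between_def)

lemma path_between_snoc:
  assumes p: "path_between D E u p v" and w: "w \<in> D" "w \<notin> set p" and e: "{v, w} \<in> E"
  shows "path_between D E u (p @ [w]) w"
  unfolding path_between_def
proof (intro conjI allI impI)
  show "hd (p @ [w]) = u" "set (p @ [w]) \<subseteq> D" "distinct (p @ [w])"
    using p w by (auto simp: path_between_def)
  fix i assume i: "Suc i < length (p @ [w])"
  show "{(p @ [w]) ! i, (p @ [w]) ! Suc i} \<in> E"
  proof (cases "Suc i < length p")
    case True
    then show ?thesis using p by (auto simp: path_between_def nth_append)
  next
    case False
    then have "Suc i = length p" using i by simp
    moreover then have "p ! i = v" using p
      by (metis diff_Suc_1 last_conv_nth path_between_def)
    ultimately show ?thesis using e by (auto simp: nth_append)
  qed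
qed auto

text \<open>The new vertex may already lie on the path; then an initial segment of the path serves.\<close>

lemma path_between_extend:
  assumes p: "path_between D E u p v" and w: "w \<in> D" and e: "{v, w} \<in> E"
  shows "\<exists>p'. path_between D E u p' w"
proof (cases "w \<in> set p")
  case True
  then obtain ys zs where eq: "p = ys @ w # zs" by (auto simp: in_set_conv_decomp)
  have "path_between D E u (ys @ [w]) w"
    unfolding path_between_def
  proof (intro conjI allI impI)
    show "hd (ys @ [w]) = u" using p eq by (cases ys) (auto simp: path_between_def)
    show "set (ys @ [w]) \<subseteq> D" "distinct (ys @ [w])" using p eq by (auto simp: path_between_def)
    fix i assume i: "Suc i < length (ys @ [w])"
    have "(ys @ [w]) ! k = p ! k" if "k < length (ys @ [w])" for k
      using that eq by (auto simp: nth_append)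
    then show "{(ys @ [w]) ! i, (ys @ [w]) ! Suc i} \<in> E"
      using p i eq by (auto simp: path_between_def)
  qed auto
  then show ?thesis by blast
next
  case False
  then show ?thesis using path_between_snoc[OF p w _ e] by blast
qed

lemma path_between_trans:
  assumes p: "path_between D E u p v" and q: "path_between D E v q w"
  shows "\<exists>p'. path_between D E u p' w"
proof -
  have q': "q \<noteq> []" "q ! 0 = v" "q ! (length q - 1) = w" "set q \<subseteq> D"
    "\<And>i. Suc i < length q \<Longrightarrow> {q ! i, q ! Suc i} \<in> E"
    using q by (auto simp: path_between_def hd_conv_nth last_conv_nth)
  have "i < length q \<Longrightarrow> \<exists>p'. path_between D E u p' (q ! i)" for i
  proof (induction i)
    case 0
    then show ?case using p q' by auto
  next
    case (Suc i)
    then show ?case using path_between_extend[of D E u _ "q ! i" "q ! Suc i"] q'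
      by (meson Suc_lessD nth_mem subsetD)
  qed
  from this[of "length q - 1"] show ?thesis using q' by auto
qed

lemma path_between_rev:
  assumes p: "path_between D E u p v"
  shows "path_between D E v (rev p) u"
  unfolding path_between_def
proof (intro conjI allI impI)
  show "rev p \<noteq> []" "hd (rev p) = v" "last (rev p) = u" "set (rev p) \<subseteq> D" "distinct (rev p)"
    using p by (auto simp: path_between_def hd_rev last_rev)
  fix i assume i: "Suc i < length (rev p)"
  let ?k = "length p - Suc (Suc i)"
  have "{p ! ?k, p ! Suc ?k} \<in> E" using p i by (auto simp: path_between_def)
  moreover have "rev p ! i = p ! Suc ?k" "rev p ! Suc i = p ! ?k"
    using i by (auto simp: rev_nth Suc_diff_Suc)
  ultimately show "{rev p ! i, rev p ! Suc i} \<in> E" by (simp add: insert_commute)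
qed

lemma path_between_Cons:
  assumes p: "path_between D E u p v" and w: "w \<in> D" "w \<notin> set p" and e: "{w, u} \<in> E"
  shows "path_between D E w (w # p) v"
  using path_between_rev[OF path_between_snoc[OF path_between_rev[OF p] w(1)]] w e
  by (simp add: insert_commute)

lemma connected_set_from_root:
  assumes "r \<in> D" and "\<And>v. v \<in> D \<Longrightarrow> \<exists>p. path_between D E v p r"
  shows "connected_set E D"
  unfolding connected_set_def using assms path_between_trans path_between_rev by (metis empty_iff)

lemma connected_set_singleton: "connected_set E {x}"
  using path_between_refl[of x "{x}" E] by (auto simp: connected_set_def)

lemma connected_set_insert:
  assumes D: "connected_set E D" and d: "d \<in> D" and e: "{b, d} \<in> E"
  shows "connected_set E (insert b D)"
proof (rule connected_set_from_root[of d])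
  fix v assume v: "v \<in> insert b D"
  show "\<exists>p. path_between (insert b D) E v p d"
  proof (cases "v \<in> D")
    case True
    then obtain p where "path_between D E v p d" using D d by (auto simp: connected_set_def)
    then show ?thesis using path_between_mono[of D E v p d "insert b D"] by blast
  next
    case False
    then show ?thesis using v d e path_between_edge[of b "insert b D" d] by auto
  qed
qed (use d in auto)

lemma connected_graph_iff:
  "connected_graph V E \<longleftrightarrow> simple_graph V E \<and> connected_set E V"
  by (auto simp: connected_graph_def connected_set_def)

text \<open>This replaces any explicit listing of the paths in a concrete graph: if the edges leaving \<open>U\<close> end
  in few vertices, then every path leaving \<open>U\<close> has one of these as its end or as an internal vertex.\<close>

lemma path_crosses_boundary:
  assumes p: "path_between V E u p v" and "u \<in> U" and "v \<notin> U"
  obtains a b where "{a, b} \<in> E" "a \<in> U" "b \<in> V - U"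
    "a = u \<or> a \<in> internal_vertices p" "b = v \<or> b \<in> internal_vertices p"
proof -
  have p': "p \<noteq> []" "p ! 0 = u" "p ! (length p - 1) = v" "set p \<subseteq> V"
    "\<And>i. Suc i < length p \<Longrightarrow> {p ! i, p ! Suc i} \<in> E"
    using p by (auto simp: path_between_def hd_conv_nth last_conv_nth)
  have int: "p ! i \<in> internal_vertices p" if "0 < i" "Suc i < length p" for i
  proof -
    have "butlast (tl p) ! (i - 1) = p ! i" "i - 1 < length (butlast (tl p))"
      using that p'(1) by (auto simp: nth_butlast nth_tl)
    then show ?thesis unfolding internal_vertices_def by (metis nth_mem)
  qed
  have "\<exists>i. Suc i < length p \<and> p ! i \<in> U \<and> p ! Suc i \<notin> U"
  proof (rule ccontr)
    assume no: "\<not> ?thesis"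
    have "i < length p \<Longrightarrow> p ! i \<in> U" for i
      using no p' \<open>u \<in> U\<close> by (induction i) (auto dest: Suc_lessD)
    from this[of "length p - 1"] show False using p' \<open>v \<notin> U\<close> by auto
  qed
  then obtain i where i: "Suc i < length p" "p ! i \<in> U" "p ! Suc i \<notin> U" by blast
  show thesis
  proof (rule that)
    show "{p ! i, p ! Suc i} \<in> E" "p ! i \<in> U" using p' i by auto
    show "p ! Suc i \<in> V - U" using p' i by (metis DiffI nth_mem subsetD)
    show "p ! i = u \<or> p ! i \<in> internal_vertices p"
      using int[of i] i p' by (cases i) auto
    show "p ! Suc i = v \<or> p ! Suc i \<in> internal_vertices p"
    proof (cases "Suc (Suc i) = length p")
      case True
      then have "length p - 1 = Suc i" by simp
      then show ?thesis using p'(3) by simp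
    next
      case False
      then show ?thesis using int[of "Suc i"] i by auto
    qed
  qed
qed

section \<open>Colourings\<close>

lemma finite_colour_counts:
  assumes "finite V"
  shows "finite {card (c ` V) | c. MVC_coloring V E c}"
proof (rule finite_subset)
  show "{card (c ` V) | c. MVC_coloring V E c} \<subseteq> {..card V}"
    using card_image_le[OF assms] by auto
qed simp

lemma card_colours_le_mvc:
  assumes "finite V" and "MVC_coloring V E c"
  shows "card (c ` V) \<le> mvc V E"
  unfolding mvc_def using assms finite_colour_counts[OF assms(1)] by (intro Max_ge) auto

lemma mvc_leI:
  assumes G: "connected_graph V E"
    and le: "\<And>c. MVC_coloring V E c \<Longrightarrow> card (c ` V) \<le> k"
  shows "mvc V E \<le> k"
proof -
  have "MVC_coloring V E (\<lambda>_. 0)"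
    using G by (auto simp: MVC_coloring_def connected_graph_def vertex_monochromatic_def)
  moreover have "finite V" using G by (simp add: connected_graph_def simple_graph_def)
  ultimately show ?thesis
    unfolding mvc_def using le finite_colour_counts[of V E] by (subst Max_le_iff) auto
qed

lemma mvc_le_card: "connected_graph V E \<Longrightarrow> mvc V E \<le> card V"
  by (rule mvc_leI) (auto simp: connected_graph_def simple_graph_def intro: card_image_le)

text \<open>A path with at most one internal vertex is monochromatic under every colouring, so an
  injective colouring is admissible.\<close>

lemma mvc_ge_card_of_diameter_two:
  assumes G: "connected_graph V E"
    and diam: "\<And>u v. u \<in> V \<Longrightarrow> v \<in> V \<Longrightarrow> u \<noteq> v \<Longrightarrow> {u, v} \<notin> E
      \<Longrightarrow> \<exists>w\<in>V. {u, w} \<in> E \<and> {w, v} \<in> E"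
  shows "card V \<le> mvc V E"
proof -
  have fin: "finite V" and two: "\<And>e. e \<in> E \<Longrightarrow> card e = 2"
    using G by (auto simp: connected_graph_def simple_graph_def)
  obtain c :: "'a \<Rightarrow> nat" where c: "inj_on c V"
    using finite_imp_inj_to_nat_seg[OF fin] by blast
  have "MVC_coloring V E c"
    unfolding MVC_coloring_def
  proof (intro ballI)
    fix u v assume u: "u \<in> V" and v: "v \<in> V"
    consider "u = v" | "u \<noteq> v" "{u, v} \<in> E" | "u \<noteq> v" "{u, v} \<notin> E" by blast
    then show "\<exists>p. path_between V E u p v \<and> vertex_monochromatic c p"
    proof cases
      case 1
      then show ?thesis using u path_between_refl[of u V E]
        by (intro exI[of _ "[u]"]) (auto simp: vertex_monochromatic_def internal_vertices_def)
    next
      case 2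
      then show ?thesis using u v path_between_edge[of u V v E]
        by (intro exI[of _ "[u, v]"]) (auto simp: vertex_monochromatic_def internal_vertices_def)
    next
      case 3
      then obtain w where w: "w \<in> V" "{u, w} \<in> E" "{w, v} \<in> E" using diam u v by blast
      then have "u \<noteq> w" "w \<noteq> v" using two[of "{u, w}"] two[of "{w, v}"] by auto
      then have "path_between V E u [u, w, v] v"
        using w u v 3 by (auto simp: path_between_def nth_Cons')
      then show ?thesis
        by (intro exI[of _ "[u, w, v]"]) (auto simp: vertex_monochromatic_def internal_vertices_def)
    qed
  qed
  from card_colours_le_mvc[OF fin this] show ?thesis by (simp add: card_image[OF c])
qed

section \<open>Growing connected sets\<close>

definition boundary :: "'a set \<Rightarrow> 'a set set \<Rightarrow> 'a set \<Rightarrow> 'a set" where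
  "boundary V E D = {v \<in> V - D. \<exists>d\<in>D. {v, d} \<in> E}"

text \<open>The vertices at distance at least two from \<open>D\<close>.\<close>

definition outside :: "'a set \<Rightarrow> 'a set set \<Rightarrow> 'a set \<Rightarrow> 'a set" where
  "outside V E D = V - D - boundary V E D"

lemma exists_boundary_outside_edge:
  assumes G: "connected_graph V E" and D: "D \<subseteq> V" "D \<noteq> {}" and O: "outside V E D \<noteq> {}"
  obtains b z where "b \<in> boundary V E D" "z \<in> outside V E D" "{b, z} \<in> E"
proof -
  obtain d v where dv: "d \<in> D" "v \<in> outside V E D" using D O by blast
  then obtain p where "path_between V E d p v"
    using G D by (fastforce simp: connected_graph_def outside_def)
  then obtain a b where ab: "{a, b} \<in> E" "a \<in> D \<union> boundary V E D" "b \<in> V - (D \<union> boundary V E D)"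
    by (rule path_crosses_boundary[where U = "D \<union> boundary V E D"])
      (use dv in \<open>auto simp: outside_def\<close>)
  moreover have "a \<notin> D" using ab by (auto simp: boundary_def insert_commute)
  ultimately show thesis using that by (auto simp: outside_def)
qed

lemma boundary_insert:
  assumes "b \<in> boundary V E D" and "D \<subseteq> V"
  shows "boundary V E (insert b D)
    = (boundary V E D - {b}) \<union> {z \<in> outside V E D. {b, z} \<in> E}"
    and "outside V E (insert b D) = outside V E D - {z \<in> outside V E D. {b, z} \<in> E}"
  using assms by (auto simp: boundary_def outside_def insert_commute)

lemma connected_set_insert_boundary:
  "connected_set E D \<Longrightarrow> b \<in> boundary V E D \<Longrightarrow> connected_set E (insert b D)"
  using connected_set_insert[of E D _ b] by (auto simp: boundary_def)

lemma card_boundary_insert: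
  assumes "finite V" and "b \<in> boundary V E D" and "D \<subseteq> V"
  shows "card (boundary V E (insert b D)) + 1
    = card (boundary V E D) + card {z \<in> outside V E D. {b, z} \<in> E}"
proof -
  have fin: "finite (boundary V E D)" "finite (outside V E D)"
    using assms(1) by (auto simp: boundary_def outside_def)
  have "(boundary V E D - {b}) \<inter> {z \<in> outside V E D. {b, z} \<in> E} = {}"
    by (auto simp: outside_def)
  then have "card (boundary V E (insert b D))
    = card (boundary V E D - {b}) + card {z \<in> outside V E D. {b, z} \<in> E}"
    unfolding boundary_insert(1)[OF assms(2,3)] using fin by (intro card_Un_disjoint) auto
  moreover have "card (boundary V E D) > 0" using fin assms(2) by (auto simp: card_gt_0_iff)
  ultimately show ?thesis using fin assms(2) by simp
qed

text \<open>Adding a boundary vertex that has an outside neighbour removes one vertex from the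
  boundary and adds at least one, so the boundary never shrinks. When nothing is left outside, the set
  is dominating and its boundary is its complement.\<close>

lemma connected_dominating_superset:
  assumes G: "connected_graph V E"
  shows "connected_set E D \<Longrightarrow> D \<subseteq> V \<Longrightarrow> \<exists>D'. connected_set E D' \<and> D' \<subseteq> V
    \<and> V - D' = boundary V E D' \<and> card (boundary V E D) \<le> card (V - D')"
proof (induction "card (outside V E D)" arbitrary: D rule: less_induct)
  case less
  have fin: "finite V" using G by (simp add: connected_graph_def simple_graph_def)
  show ?case
  proof (cases "outside V E D = {}")
    case True
    then have "V - D = boundary V E D" by (auto simp: outside_def boundary_def)
    then show ?thesis using less.prems by auto
  next
    case False
    then obtain b z where bz: "b \<in> boundary V E D" "z \<in> outside V E D" "{b, z} \<in> E"
      using exists_boundary_outside_edge[OF G less.prems(2) _ False] less.prems(1)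
      by (auto simp: connected_set_def)
    have fO: "finite (outside V E D)" using fin by (simp add: outside_def)
    have "card {z \<in> outside V E D. {b, z} \<in> E} > 0" using fO bz by (auto simp: card_gt_0_iff)
    then have "card (boundary V E D) \<le> card (boundary V E (insert b D))"
      using card_boundary_insert[OF fin bz(1) less.prems(2)] by linarith
    moreover have "card (outside V E (insert b D)) < card (outside V E D)"
      unfolding boundary_insert(2)[OF bz(1) less.prems(2)] using bz fO by (intro psubset_card_mono) auto
    moreover have "connected_set E (insert b D)"
      using connected_set_insert_boundary[OF less.prems(1) bz(1)] .
    moreover have "insert b D \<subseteq> V" using less.prems(2) bz by (auto simp: boundary_def)
    ultimately show ?thesis using less.hyps[of "insert b D"] order_trans by blast
  qed
qed

text \<open>The colouring gives \<open>0\<close> to a connected dominating superset of \<open>D\<close> and a private colour to every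
  other vertex. Two vertices are joined by a path that has all its internal vertices in that superset.\<close>

lemma mvc_gt_card_boundary:
  assumes G: "connected_graph V E" and D: "connected_set E D" "D \<subseteq> V"
  shows "card (boundary V E D) + 1 \<le> mvc V E"
proof -
  have fin: "finite V" using G by (simp add: connected_graph_def simple_graph_def)
  obtain D' where D': "connected_set E D'" "D' \<subseteq> V" "V - D' = boundary V E D'"
    "card (boundary V E D) \<le> card (V - D')"
    using connected_dominating_superset[OF G D] by blast
  obtain f :: "'a \<Rightarrow> nat" where f: "inj_on f V"
    using finite_imp_inj_to_nat_seg[OF fin] by blast
  define c where "c v = (if v \<in> D' then 0 else Suc (f v))" for v
  have attach: "\<exists>d\<in>D'. v = d \<or> v \<notin> D' \<and> {v, d} \<in> E" if "v \<in> V" for v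
    using that D'(3) by (cases "v \<in> D'") (auto simp: boundary_def)
  have "MVC_coloring V E c"
    unfolding MVC_coloring_def
  proof (intro ballI)
    fix u v assume uv: "u \<in> V" "v \<in> V"
    show "\<exists>p. path_between V E u p v \<and> vertex_monochromatic c p"
    proof (cases "u = v")
      case True
      then show ?thesis using uv path_between_refl[of u V E]
        by (intro exI[of _ "[u]"]) (auto simp: vertex_monochromatic_def internal_vertices_def)
    next
      case False
      obtain a where a: "a \<in> D'" "u = a \<or> u \<notin> D' \<and> {u, a} \<in> E" using attach uv by blast
      obtain b where b: "b \<in> D'" "v = b \<or> v \<notin> D' \<and> {v, b} \<in> E" using attach uv by blast
      obtain p where p: "path_between D' E a p b"
        using D'(1) a b by (auto simp: connected_set_def)
      \<comment> \<open>The attached ends must not be repeated when \<open>u\<close> or \<open>v\<close> already lies in \<open>D'\<close>.\<close>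
      define p1 where "p1 = (if u = a then p else u # p)"
      define p2 where "p2 = (if v = b then p1 else p1 @ [v])"
      have pD: "set p \<subseteq> D'" "p \<noteq> []" using p by (auto simp: path_between_def)
      have p': "path_between V E a p b" using path_between_mono[OF p D'(2)] .
      have 1: "path_between V E u p1 b"
        using path_between_Cons[OF p', of u] p' a uv pD by (auto simp: p1_def)
      have "v \<noteq> b \<Longrightarrow> v \<notin> set p1" using pD b False by (auto simp: p1_def)
      then have 2: "path_between V E u p2 v"
        using path_between_snoc[OF 1, of v] 1 b uv by (auto simp: p2_def insert_commute)
      have "set (butlast (tl p2)) \<subseteq> D'"
      proof -
        have "set (tl p1) \<subseteq> D'" "p1 \<noteq> []"
          using pD by (auto simp: p1_def dest: list.set_sel(2))
        then show ?thesis by (auto simp: p2_def dest: in_set_butlastD)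
      qed
      then have "vertex_monochromatic c p2"
        by (auto simp: vertex_monochromatic_def internal_vertices_def c_def)
      then show ?thesis using 2 by blast
    qed
  qed
  then have "card (c ` V) \<le> mvc V E" by (rule card_colours_le_mvc[OF fin])
  moreover have "card (c ` V) = card (V - D') + 1"
  proof -
    have "c ` V = insert 0 ((Suc \<circ> f) ` (V - D'))"
      using D'(1,2) by (auto simp: c_def connected_set_def image_iff)
    moreover have "inj_on (Suc \<circ> f) (V - D')"
      using f by (auto simp: inj_on_def)
    then have "card ((Suc \<circ> f) ` (V - D')) = card (V - D')" by (rule card_image)
    moreover have "0 \<notin> (Suc \<circ> f) ` (V - D')" by auto
    ultimately show ?thesis using fin by (metis Suc_eq_plus1 card_insert_disjoint finite_Diff finite_imageI)
  qed
  ultimately show ?thesis using D'(4) by linarith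
qed

section \<open>Counting edges\<close>

text \<open>Edges inside \<open>X \<inter> Y\<close> are counted twice, so that the count is additive in both
  arguments and symmetric; counting ordered pairs avoids a case distinction for \<open>X = Y\<close>.\<close>

definition degree_sum :: "'a set set \<Rightarrow> 'a set \<Rightarrow> 'a set \<Rightarrow> nat" where
  "degree_sum E X Y = (\<Sum>v\<in>X. card {u \<in> Y. {v, u} \<in> E})"

lemma degree_sum_commute:
  assumes "finite X" and "finite Y"
  shows "degree_sum E X Y = degree_sum E Y X"
proof -
  have card: "card {u \<in> Z. {v, u} \<in> E} = (\<Sum>u\<in>Z. if {v, u} \<in> E then 1 else 0)" if "finite Z" for v Z
    using that by (simp add: sum.If_cases Int_def)
  have "degree_sum E X Y = (\<Sum>v\<in>X. \<Sum>u\<in>Y. if {v, u} \<in> E then 1 else 0)"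
    by (simp add: degree_sum_def card assms)
  also have "\<dots> = (\<Sum>u\<in>Y. \<Sum>v\<in>X. if {u, v} \<in> E then 1 else 0)"
    by (subst sum.swap) (simp add: insert_commute)
  also have "\<dots> = degree_sum E Y X"
    by (simp add: degree_sum_def card assms)
  finally show ?thesis .
qed

lemma degree_sum_Un_left:
  "finite X \<Longrightarrow> finite Y \<Longrightarrow> X \<inter> Y = {} \<Longrightarrow> degree_sum E (X \<union> Y) Z = degree_sum E X Z + degree_sum E Y Z"
  by (simp add: degree_sum_def sum.union_disjoint)

lemma degree_sum_Un_right:
  assumes "finite X" and "finite Y" and "X \<inter> Y = {}"
  shows "degree_sum E Z (X \<union> Y) = degree_sum E Z X + degree_sum E Z Y"
proof -
  have "{u \<in> X \<union> Y. {v, u} \<in> E} = {u \<in> X. {v, u} \<in> E} \<union> {u \<in> Y. {v, u} \<in> E}" for v by auto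
  moreover have "{u \<in> X. {v, u} \<in> E} \<inter> {u \<in> Y. {v, u} \<in> E} = {}" for v using assms(3) by auto
  ultimately have "card {u \<in> X \<union> Y. {v, u} \<in> E}
      = card {u \<in> X. {v, u} \<in> E} + card {u \<in> Y. {v, u} \<in> E}" for v
    using assms by (simp add: card_Un_disjoint)
  then show ?thesis by (simp add: degree_sum_def sum.distrib)
qed

lemma degree_sum_le:
  assumes "\<And>v. v \<in> X \<Longrightarrow> card {u \<in> Y. {v, u} \<in> E} \<le> k"
  shows "degree_sum E X Y \<le> card X * k"
  using sum_bounded_above[of X "\<lambda>v. card {u \<in> Y. {v, u} \<in> E}" k] assms
  by (simp add: degree_sum_def)

lemma handshake:
  assumes "finite X" and two: "\<And>e. e \<in> E \<Longrightarrow> card e = 2"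
  shows "degree_sum E X X = 2 * card {e \<in> E. e \<subseteq> X}"
  using assms(1)
proof (induction X rule: finite_induct)
  case empty
  have "{e \<in> E. e \<subseteq> {}} = {}" using two by fastforce
  then show ?case by (simp add: degree_sum_def)
next
  case (insert x X)
  let ?N = "{u \<in> X. {x, u} \<in> E}"
  have noloop: "{x, x} \<notin> E" using two[of "{x, x}"] by auto
  have split: "{e \<in> E. e \<subseteq> insert x X} = {e \<in> E. e \<subseteq> X} \<union> (\<lambda>u. {x, u}) ` ?N"
  proof (intro equalityI subsetI)
    fix e assume e: "e \<in> {e \<in> E. e \<subseteq> insert x X}"
    then obtain a b where "e = {a, b}" "a \<noteq> b" using two[of e] by (auto simp: card_2_iff)
    then show "e \<in> {e \<in> E. e \<subseteq> X} \<union> (\<lambda>u. {x, u}) ` ?N"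
      using e by (auto simp: insert_commute)
  qed auto
  have "inj_on (\<lambda>u. {x, u}) ?N" by (auto simp: inj_on_def doubleton_eq_iff)
  then have "card ((\<lambda>u. {x, u}) ` ?N) = card ?N" by (rule card_image)
  moreover have "{e \<in> E. e \<subseteq> X} \<inter> (\<lambda>u. {x, u}) ` ?N = {}" using insert by auto
  moreover have "finite {e \<in> E. e \<subseteq> X}" using insert by (auto intro: finite_subset[of _ "Pow X"])
  ultimately have "card {e \<in> E. e \<subseteq> insert x X} = card {e \<in> E. e \<subseteq> X} + card ?N"
    unfolding split using insert by (simp add: card_Un_disjoint)
  moreover have "degree_sum E (insert x X) (insert x X) = degree_sum E X X + 2 * card ?N"
  proof -
    have "degree_sum E {x} X = card ?N" "degree_sum E {x} {x} = 0"
      using noloop by (auto simp: degree_sum_def)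
    then show ?thesis
      using degree_sum_Un_left[of "{x}" X E "{x} \<union> X"] degree_sum_Un_right[of "{x}" X E] insert
        degree_sum_commute[of X "{x}" E]
      by simp
  qed
  ultimately show ?case using insert.IH by simp
qed

lemma card_edges_plus_nonedges:
  assumes "finite W" and "\<And>e. e \<in> E \<Longrightarrow> card e = 2"
  shows "card {e \<in> E. e \<subseteq> W} + card {e. e \<subseteq> W \<and> card e = 2 \<and> e \<notin> E} = card W choose 2"
proof -
  have "{e \<in> E. e \<subseteq> W} \<union> {e. e \<subseteq> W \<and> card e = 2 \<and> e \<notin> E} = {e. e \<subseteq> W \<and> card e = 2}"
    using assms(2) by auto
  moreover have "{e \<in> E. e \<subseteq> W} \<inter> {e. e \<subseteq> W \<and> card e = 2 \<and> e \<notin> E} = {}" by auto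
  moreover have "finite {e \<in> E. e \<subseteq> W}" "finite {e. e \<subseteq> W \<and> card e = 2 \<and> e \<notin> E}"
    using assms(1) by (auto intro: finite_subset[of _ "Pow W"])
  ultimately show ?thesis using n_subsets[OF assms(1), of 2]
      card_Un_disjoint[of "{e \<in> E. e \<subseteq> W}" "{e. e \<subseteq> W \<and> card e = 2 \<and> e \<notin> E}"] by simp
qed

text \<open>Start with the identity; each edge merges two labels and so loses at most one. The labels play the
  role of connected components.\<close>

lemma exists_edge_invariant_labelling:
  fixes F :: "'a set set"
  assumes "finite F" and "\<And>e. e \<in> F \<Longrightarrow> card e = 2" and "finite A"
  shows "\<exists>c :: 'a \<Rightarrow> 'a. (\<forall>p q. {p, q} \<in> F \<longrightarrow> c p = c q) \<and> card A \<le> card (c ` A) + card F"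
  using assms(1,2)
proof (induction F rule: finite_induct)
  case empty
  then show ?case by (intro exI[of _ id]) auto
next
  case (insert e F)
  then obtain c :: "'a \<Rightarrow> 'a" where c: "\<And>p q. {p, q} \<in> F \<Longrightarrow> c p = c q"
    "card A \<le> card (c ` A) + card F" by auto
  obtain p q where e: "e = {p, q}" using insert.prems[of e] by (auto simp: card_2_iff)
  define c' where "c' x = (if c x = c q then c p else c x)" for x
  have inv: "c' a = c' b" if "{a, b} \<in> insert e F" for a b
    using that c(1)[of a b] by (auto simp: e c'_def doubleton_eq_iff)
  have "c ` A - {c q} \<subseteq> c' ` A" by (auto simp: c'_def image_iff)
  then have "card (c ` A - {c q}) \<le> card (c' ` A)" using assms(3) by (intro card_mono) auto
  then have "card (c ` A) \<le> card (c' ` A) + 1" using assms(3)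
    by (auto simp: card_Diff_singleton_if split: if_splits)
  then have "card A \<le> card (c' ` A) + card (insert e F)" using c(2) insert by simp
  then show ?case using inv by blast
qed

text \<open>The familiar bound that linking the vertices of \<open>A\<close> takes at least \<open>card A - 1\<close> edges. The
  hypothesis \<open>conn\<close> expresses that \<open>A\<close> lies in one component of \<open>F\<close>.\<close>

lemma card_le_of_connecting_edges:
  fixes F :: "'a set set"
  assumes "finite F" and "\<And>e. e \<in> F \<Longrightarrow> card e = 2" and "finite A"
    and conn: "\<And>c :: 'a \<Rightarrow> 'a. (\<And>p q. {p, q} \<in> F \<Longrightarrow> c p = c q)
      \<Longrightarrow> (\<And>a b. a \<in> A \<Longrightarrow> b \<in> A \<Longrightarrow> c a = c b)"
  shows "card A \<le> card F + 1"
proof -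
  obtain c :: "'a \<Rightarrow> 'a" where c: "\<And>p q. {p, q} \<in> F \<Longrightarrow> c p = c q"
    "card A \<le> card (c ` A) + card F" using exists_edge_invariant_labelling[OF assms(1-3)] by auto
  have "\<forall>p\<in>c ` A. \<forall>q\<in>c ` A. p = q"
  proof (intro ballI)
    fix p q assume "p \<in> c ` A" "q \<in> c ` A"
    then obtain a b where ab: "a \<in> A" "b \<in> A" "p = c a" "q = c b" by blast
    show "p = q" unfolding ab(3,4) by (rule conn[of c, OF c(1) ab(1,2)])
  qed
  then have "card (c ` A) \<le> 1"
    using card_le_Suc0_iff_eq[OF finite_imageI[OF assms(3)], of c] unfolding One_nat_def by (rule iffD2[rotated])
  then show ?thesis using c(2) by linarith
qed

section \<open>Many edges force a connected set with a large boundary\<close>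

text \<open>Here \<open>j\<close> is the number of vertices by which the boundary of \<open>D\<close> can still grow. Choose a boundary
  vertex \<open>b\<close> with the largest number \<open>g + 1\<close> of outside neighbours. Adding \<open>b\<close> gains \<open>g\<close> boundary
  vertices and moves a set \<open>K\<close> of \<open>g + 1\<close> outside vertices to the boundary. If the new outside set
  \<open>O'\<close> is nonempty and \<open>g'\<close> is the gain of the next greedy step, each vertex of \<open>K\<close> has at most \<open>g' + 1\<close>
  neighbours in \<open>O'\<close>, so that the edge numbers of the outside sets before and after the step satisfy
  
  \<open>2 e(O) \<le> (g + 1) g + 2 (g + 1) (g' + 1) + 2 e(O')\<close>.
  
  The term \<open>2 * g\<close> in the claim is what makes the induction close: the bound for \<open>O'\<close> then yields the
  one for \<open>O\<close> with \<open>2 g (j - g - g')\<close> to spare, which is nonnegative because the next gain must fit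
  into the remaining \<open>j - g\<close>.\<close>

lemma growth_bound:
  assumes G: "connected_graph V E"
    and bound: "\<And>D. connected_set E D \<Longrightarrow> D \<subseteq> V \<Longrightarrow> card (boundary V E D) \<le> t"
  shows "connected_set E D \<Longrightarrow> D \<subseteq> V \<Longrightarrow> outside V E D \<noteq> {}
    \<Longrightarrow> card (boundary V E D) + j = t \<Longrightarrow> \<exists>g\<le>j.
      (\<forall>b\<in>boundary V E D. card {z \<in> outside V E D. {b, z} \<in> E} \<le> g + 1)
      \<and> degree_sum E (outside V E D) (outside V E D) + 2 * g + 2
        \<le> j * j + 3 * j + 2 * card (outside V E D)"
proof (induction "card (outside V E D)" arbitrary: D j rule: less_induct)
  case less
  have fin: "finite V" and two: "\<And>e. e \<in> E \<Longrightarrow> card e = 2"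
    using G by (auto simp: connected_graph_def simple_graph_def)
  let ?B = "boundary V E D" and ?O = "outside V E D"
  let ?f = "\<lambda>b. card {z \<in> ?O. {b, z} \<in> E}"
  have fB: "finite ?B" and fO: "finite ?O" using fin by (auto simp: boundary_def outside_def)
  have D0: "D \<noteq> {}" using less.prems(1) by (simp add: connected_set_def)
  obtain b0 z0 where bz: "b0 \<in> ?B" "z0 \<in> ?O" "{b0, z0} \<in> E"
    using exists_boundary_outside_edge[OF G less.prems(2) D0 less.prems(3)] by blast
  have "Max (?f ` ?B) \<in> ?f ` ?B" using fB bz by (intro Max_in) auto
  then obtain b where b: "b \<in> ?B" "?f b = Max (?f ` ?B)" by force
  have max: "?f b' \<le> ?f b" if "b' \<in> ?B" for b' using that fB b by simp
  have "?f b0 > 0" using fO bz by (auto simp: card_gt_0_iff)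
  then have "?f b > 0" using max[OF bz(1)] by linarith
  then obtain g where g: "?f b = g + 1" by (metis Suc_eq_plus1 gr0_implies_Suc)
  let ?K = "{z \<in> ?O. {b, z} \<in> E}" and ?D = "insert b D"
  have fK: "finite ?K" using fO by simp
  have D': "connected_set E ?D" "?D \<subseteq> V"
    using connected_set_insert_boundary[OF less.prems(1) b(1)] less.prems(2) b(1)
    by (auto simp: boundary_def)
  have cB: "card (boundary V E ?D) = card ?B + g"
    using card_boundary_insert[OF fin b(1) less.prems(2)] g by simp
  then have gj: "g \<le> j" using bound[OF D'] less.prems(4) by linarith
  then obtain d where d: "j = g + d" using le_Suc_ex by blast
  let ?O' = "outside V E ?D"
  have O': "?O' = ?O - ?K" using boundary_insert(2)[OF b(1) less.prems(2)] .
  have O_eq: "?O = ?K \<union> ?O'" and dis: "?K \<inter> ?O' = {}" and fO': "finite ?O'"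
    using fO unfolding O' by auto
  have cO: "card ?O = g + 1 + card ?O'"
    using card_Un_disjoint[OF fK fO' dis] O_eq g by simp
  have "card {u \<in> ?K. {v, u} \<in> E} \<le> g" if "v \<in> ?K" for v
  proof -
    have "{v, v} \<notin> E" using two[of "{v, v}"] by auto
    then have "card {u \<in> ?K. {v, u} \<in> E} \<le> card (?K - {v})"
      using fK by (intro card_mono) auto
    then show ?thesis using that g fK by simp
  qed
  then have KK: "degree_sum E ?K ?K \<le> (g + 1) * g"
    using degree_sum_le[of ?K ?K E g] g by simp
  have "degree_sum E ?O ?O = degree_sum E ?K (?K \<union> ?O') + degree_sum E ?O' (?K \<union> ?O')"
    using degree_sum_Un_left[OF fK fO' dis, of E] O_eq by metis
  then have split: "degree_sum E ?O ?O
      = degree_sum E ?K ?K + 2 * degree_sum E ?K ?O' + degree_sum E ?O' ?O'"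
    using degree_sum_Un_right[OF fK fO' dis] degree_sum_commute[OF fK fO', of E] by simp
  have "degree_sum E ?O ?O + 2 * g + 2 \<le> j * j + 3 * j + 2 * card ?O"
  proof (cases "?O' = {}")
    case True
    have "degree_sum E ?K ?O' = 0" "degree_sum E ?O' ?O' = 0"
      using True by (auto simp: degree_sum_def)
    then have "degree_sum E ?O ?O \<le> g * g + g" using split KK by simp
    moreover have "g * g \<le> j * j" using gj by (rule mult_le_mono[OF _ gj])
    ultimately show ?thesis using cO True gj by simp
  next
    case False
    have "card ?O' < card ?O" using cO by simp
    moreover have "card (boundary V E ?D) + d = t" using cB less.prems(4) d by simp
    ultimately obtain g' where g': "g' \<le> d"
      "\<And>b'. b' \<in> boundary V E ?D \<Longrightarrow> card {z \<in> ?O'. {b', z} \<in> E} \<le> g' + 1"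
      "degree_sum E ?O' ?O' + 2 * g' + 2 \<le> d * d + 3 * d + 2 * card ?O'"
      using less.hyps[OF _ D' False] by blast
    have "?K \<subseteq> boundary V E ?D" using boundary_insert(1)[OF b(1) less.prems(2)] by auto
    then have "degree_sum E ?K ?O' \<le> (g + 1) * (g' + 1)"
      using degree_sum_le[of ?K ?O' E "g' + 1"] g' g by auto
    moreover have "(g + 1) * (g' + 1) = g * g' + g + g' + 1" by simp
    moreover have "(g + 1) * g = g * g + g" by simp
    moreover have "j * j = g * g + 2 * (g * d) + d * d" by (simp add: d algebra_simps)
    moreover have "g * g' \<le> g * d" using g'(1) by (rule mult_le_mono2)
    ultimately show ?thesis using split KK g'(3) cO d by linarith
  qed
  then show ?case using max g gj by auto
qed

text \<open>The bound \<open>card V \<ge> t + 3\<close> is essential: the complete graph on \<open>t + 2\<close> vertices minus a perfect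
  matching (\<open>t \<ge> 4\<close> even) has enough edges but no dominating vertex. When the maximum degree is \<open>t\<close>, the
  bound provides a second vertex at distance at least two from the starting vertex.\<close>

lemma exists_large_boundary:
  assumes G: "connected_graph V E" and n: "t + 3 \<le> card V"
    and m: "card V + (t choose 2) \<le> card E"
  shows "\<exists>D. connected_set E D \<and> D \<subseteq> V \<and> t + 1 \<le> card (boundary V E D)"
proof (rule ccontr)
  assume none: "\<not> ?thesis"
  have bound: "card (boundary V E D) \<le> t" if "connected_set E D" "D \<subseteq> V" for D
  proof (rule ccontr)
    assume "\<not> ?thesis"
    then have "t + 1 \<le> card (boundary V E D)" by simp
    then show False using none that by blast
  qed
  have fin: "finite V" and two: "\<And>e. e \<in> E \<Longrightarrow> card e = 2" and sub: "\<And>e. e \<in> E \<Longrightarrow> e \<subseteq> V"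
    using G by (auto simp: connected_graph_def simple_graph_def)
  have noloop: "{v, v} \<notin> E" for v using two[of "{v, v}"] by auto
  have fB: "finite (boundary V E D)" for D using fin by (simp add: boundary_def)
  let ?deg = "\<lambda>v. card {u \<in> V. {v, u} \<in> E}"
  have "Max (?deg ` V) \<in> ?deg ` V" using fin n by (intro Max_in) auto
  then obtain x where x: "x \<in> V" "?deg x = Max (?deg ` V)" by force
  have max: "?deg v \<le> ?deg x" if "v \<in> V" for v using that fin x by simp
  define R where "R = boundary V E {x}"
  define S where "S = outside V E {x}"
  have R: "R = {u \<in> V. {x, u} \<in> E}"
    using noloop by (auto simp: R_def boundary_def insert_commute)
  have conn: "connected_set E {x}" "{x} \<subseteq> V" using connected_set_singleton x by auto
  have fR: "finite R" and fS: "finite S" using fin by (auto simp: R S_def outside_def)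
  have V_eq: "V = {x} \<union> R \<union> S" and dis: "x \<notin> R" "x \<notin> S" "R \<inter> S = {}"
    using x noloop by (auto simp: R S_def outside_def R_def[symmetric])
  have V: "R \<subseteq> V" "S \<subseteq> V" "\<And>v. v \<in> V \<Longrightarrow> v = x \<or> v \<in> R \<or> v \<in> S"
    and R_iff: "\<And>v. v \<in> R \<longleftrightarrow> v \<in> V \<and> {x, v} \<in> E"
    using V_eq R by blast+
  have "card ({x} \<union> R \<union> S) = card R + 1 + card S"
    using dis fR fS by (simp add: card_Un_disjoint)
  then have nS: "card V = card R + 1 + card S" using V_eq by simp
  have Rt: "card R \<le> t" using bound[OF conn] by (simp add: R_def)
  then obtain j where j: "card R + j = t" using le_Suc_ex by metis
  \<comment> \<open>\<open>x\<close> has degree \<open>t - j\<close>, and \<open>S\<close> consists of the vertices at distance at least two from \<open>x\<close>.\<close>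
  have S0: "S \<noteq> {}" using nS n Rt by auto
  obtain g where g: "g \<le> j" "\<And>b. b \<in> R \<Longrightarrow> card {z \<in> S. {b, z} \<in> E} \<le> g + 1"
    "degree_sum E S S + 2 * g + 2 \<le> j * j + 3 * j + 2 * card S"
    using growth_bound[OF G bound conn, of j] S0 j unfolding R_def S_def by blast
  have "{e \<in> E. e \<subseteq> V} = E" using sub by auto
  then have mm: "2 * card E = degree_sum E V V" using handshake[OF fin two] by simp
  have "even (t * (t - 1))" by (cases t) auto
  then have t2: "2 * (t choose 2) = t * (t - 1)" by (simp add: choose_two)
  show False
  proof (cases j)
    case (Suc i)
    have "degree_sum E ({x} \<union> R) V \<le> card ({x} \<union> R) * card R"
      using degree_sum_le[of "{x} \<union> R" V E "card R"] max V(1) x(1) R by blast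
    then have 1: "degree_sum E ({x} \<union> R) V \<le> (card R + 1) * card R"
      using dis fR by simp
    have "degree_sum E R S \<le> card R * (g + 1)" using degree_sum_le[of R S E "g + 1"] g(2) by blast
    then have 2: "degree_sum E S R \<le> card R * (g + 1)" using degree_sum_commute[OF fR fS] by metis
    have "{z, x} \<notin> E" if "z \<in> S" for z
      using that V(2) dis R_iff[of z] by (auto simp: insert_commute)
    then have "{u \<in> {x}. {z, u} \<in> E} = {}" if "z \<in> S" for z using that by blast
    then have 3: "degree_sum E S {x} = 0" unfolding degree_sum_def by (intro sum.neutral) simp
    have "degree_sum E V V = degree_sum E ({x} \<union> R) V + degree_sum E S V"
      using degree_sum_Un_left[of "{x} \<union> R" S E V] V_eq dis fR fS by auto
    moreover have "degree_sum E S V = degree_sum E S {x} + degree_sum E S R + degree_sum E S S"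
      using degree_sum_Un_right[of "{x} \<union> R" S E S] degree_sum_Un_right[of "{x}" R E S] V_eq dis fR fS
      by auto
    ultimately have 4: "degree_sum E V V
        \<le> (card R + 1) * card R + card R * (g + 1) + degree_sum E S S"
      using 1 2 3 by linarith
    \<comment> \<open>With \<open>a\<close> for the maximum degree, the upper and the lower bound on the degree sum differ
        by \<open>(2 j - 1 - g) (a - 2) + 2 > 0\<close>, in the wrong direction. Both factors are
        nonnegative because \<open>g \<le> j\<close>, \<open>j \<ge> 1\<close> and the average degree is at least two.\<close>
    define a where "a = int (card R)"
    have "2 * card V \<le> degree_sum E V V" using mm m by linarith
    moreover have "degree_sum E V V \<le> card V * card R"
      using degree_sum_le[of V V E "card R"] max R by auto
    ultimately have "2 \<le> card R" using n by (metis add_is_0 le_trans mult.commute mult_le_cancel1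
      not_gr_zero le_zero_eq zero_neq_numeral)
    then have a2: "a \<ge> 2" by (simp add: a_def)
    have "2 * card V + t * (t - 1) \<le> degree_sum E V V" using m mm t2 by linarith
    then have "2 * card V + t * (t - 1)
        \<le> (card R + 1) * card R + card R * (g + 1) + degree_sum E S S" using 4 by linarith
    moreover have "int (t * (t - 1)) = (a + int j) * (a + int j - 1)"
      using j Suc by (auto simp: a_def of_nat_diff)
    ultimately have "2 * (a + 1 + int (card S)) + (a + int j) * (a + int j - 1)
        \<le> (a + 1) * a + a * (int g + 1) + int (degree_sum E S S)"
      unfolding nS a_def by (metis (mono_tags, lifting) of_nat_1 of_nat_add of_nat_le_iff of_nat_mult of_nat_numeral)
    moreover have "int (degree_sum E S S) + 2 * int g + 2 \<le> int j * int j + 3 * int j + 2 * int (card S)"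
      using g(3) by (metis (mono_tags, lifting) of_nat_add of_nat_le_iff of_nat_mult of_nat_numeral)
    moreover have "(2 * int j - 1 - int g) * (a - 2) \<ge> 0"
      using g(1) Suc a2 by (intro mult_nonneg_nonneg) auto
    ultimately show False by (simp add: algebra_simps)
  next
    case 0
    then have tR: "card R = t" and g0: "g = 0" using j g by auto
    have S2: "2 \<le> card S" using nS n tR by simp
    \<comment> \<open>Now \<open>g = 0\<close>: every \<open>r \<in> R\<close> has at most one neighbour \<open>s r\<close> in \<open>S\<close>, and \<open>S\<close> spans
        fewer than \<open>card S\<close> edges. Counting all edges, the set \<open>F\<close> of nonadjacent pairs in \<open>R\<close> must have at
        most \<open>card A - 2\<close> elements; both cases below give at least \<open>card A - 1\<close>.\<close>
    define A where "A = {r \<in> R. \<exists>z\<in>S. {r, z} \<in> E}"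
    define s where "s r = (SOME z. z \<in> S \<and> {r, z} \<in> E)" for r
    have s: "s r \<in> S" "{r, s r} \<in> E" if "r \<in> A" for r
      using that someI_ex[of "\<lambda>z. z \<in> S \<and> {r, z} \<in> E"] by (auto simp: A_def s_def)
    have uniq: "z = s r" if "r \<in> A" "z \<in> S" "{r, z} \<in> E" for r z
    proof -
      have "card {z \<in> S. {r, z} \<in> E} \<le> 1" using g(2)[of r] g0 that by (auto simp: A_def)
      then show ?thesis using that s[OF that(1)] fS
        card_le_Suc0_iff_eq[of "{z \<in> S. {r, z} \<in> E}"] by simp
    qed
    have fA: "finite A" and AR: "A \<subseteq> R" using fR by (auto simp: A_def)
    define F where "F = {e. e \<subseteq> R \<and> card e = 2 \<and> e \<notin> E}"
    have fF: "finite F" using fR by (auto simp: F_def intro: finite_subset[of _ "Pow R"])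
    have inF: "{p, q} \<in> F" if "p \<in> R" "q \<in> R" "p \<noteq> q" "{p, q} \<notin> E" for p q
      using that by (auto simp: F_def)
    have eF: "card {e \<in> E. e \<subseteq> R} + card F = t choose 2"
      using card_edges_plus_nonedges[OF fR, of E] two tR by (simp add: F_def)
    have eS: "card {e \<in> E. e \<subseteq> S} + 1 \<le> card S"
      using handshake[OF fS, of E] two g(3) g0 0 by simp
    have "E \<subseteq> {e \<in> E. e \<subseteq> R} \<union> {e \<in> E. e \<subseteq> S} \<union> (\<lambda>r. {x, r}) ` R \<union> (\<lambda>r. {r, s r}) ` A"
    proof
      fix e assume e: "e \<in> E"
      then obtain p q where pq: "e = {p, q}" "p \<noteq> q" using two[of e] by (auto simp: card_2_iff)
      have RS: "{r, z} \<in> (\<lambda>r. {r, s r}) ` A" if "r \<in> R" "z \<in> S" "{r, z} \<in> E" for r z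
      proof -
        have "r \<in> A" using that by (auto simp: A_def)
        then show ?thesis using uniq[of r z] that by auto
      qed
      have "p \<in> {x} \<union> R \<union> S" "q \<in> {x} \<union> R \<union> S" using sub[OF e] pq V(3) by auto
      moreover have "p = x \<Longrightarrow> q \<in> R" "q = x \<Longrightarrow> p \<in> R"
        using e pq sub[OF e] by (auto simp: R_iff insert_commute)
      ultimately show "e \<in> {e \<in> E. e \<subseteq> R} \<union> {e \<in> E. e \<subseteq> S} \<union> (\<lambda>r. {x, r}) ` R \<union> (\<lambda>r. {r, s r}) ` A"
        using e pq RS[of p q] RS[of q p] by (auto simp: insert_commute)
    qed
    then have "card E \<le> card ({e \<in> E. e \<subseteq> R} \<union> {e \<in> E. e \<subseteq> S} \<union> (\<lambda>r. {x, r}) ` R \<union> (\<lambda>r. {r, s r}) ` A)"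
      using fR fS fA by (intro card_mono) (auto intro: finite_subset[of _ "Pow R"] finite_subset[of _ "Pow S"])
    also have "\<dots> \<le> card {e \<in> E. e \<subseteq> R} + card {e \<in> E. e \<subseteq> S} + card R + card A"
      using card_Un_le card_image_le fR fA by (smt (verit) add_mono le_trans)
    finally have FA: "card F + 2 \<le> card A" using eF eS m nS tR by linarith
    show False
    proof (cases "\<exists>a\<in>A. \<exists>b\<in>A. s a \<noteq> s b")
      case True
      then obtain a0 b0 where ab0: "a0 \<in> A" "b0 \<in> A" "s a0 \<noteq> s b0" by blast
      \<comment> \<open>Otherwise \<open>{a, b}\<close> is connected and its boundary contains \<open>x\<close>, \<open>s a\<close>, \<open>s b\<close> and the
          other \<open>t - 2\<close> vertices of \<open>R\<close>.\<close>
      have link: "{a, b} \<in> F \<or> (\<exists>y. {a, y} \<in> F \<and> {y, b} \<in> F)"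
        if ab: "a \<in> A" "b \<in> A" "s a \<noteq> s b" for a b
      proof (rule ccontr)
        assume no: "\<not> ?thesis"
        have "a \<noteq> b" "a \<in> R" "b \<in> R" using ab AR by auto
        then have "{a, b} \<in> E" using no inF by blast
        then have "connected_set E {a, b}" using connected_set_insert[OF connected_set_singleton, of b b a E] by simp
        moreover have "{a, b} \<subseteq> V" using \<open>a \<in> R\<close> \<open>b \<in> R\<close> V by auto
        ultimately have le: "card (boundary V E {a, b}) \<le> t" by (rule bound)
        have "y \<in> boundary V E {a, b}" if y: "y \<in> R - {a, b}" for y
        proof -
          have "{a, y} \<in> E \<or> {y, b} \<in> E" using no inF y \<open>a \<in> R\<close> \<open>b \<in> R\<close> by blast
          then show ?thesis using y V by (auto simp: boundary_def insert_commute)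
        qed
        moreover have "x \<in> boundary V E {a, b}"
          using \<open>a \<in> R\<close> x dis \<open>b \<in> R\<close> by (auto simp: boundary_def R_iff)
        moreover have "s a \<in> boundary V E {a, b}" "s b \<in> boundary V E {a, b}"
          using s[OF ab(1)] s[OF ab(2)] V dis \<open>a \<in> R\<close> \<open>b \<in> R\<close>
          by (auto simp: boundary_def insert_commute)
        ultimately have "(R - {a, b}) \<union> {x, s a, s b} \<subseteq> boundary V E {a, b}" by auto
        then have "card ((R - {a, b}) \<union> {x, s a, s b}) \<le> t"
          using le card_mono[OF fB] order_trans by blast
        moreover have "card ((R - {a, b}) \<union> {x, s a, s b}) = card (R - {a, b}) + card {x, s a, s b}"
          using dis s[OF ab(1)] s[OF ab(2)] fR by (intro card_Un_disjoint) auto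
        moreover have "x \<noteq> s a" "x \<noteq> s b" using dis(2) s(1)[OF ab(1)] s(1)[OF ab(2)] by auto
        then have "card {x, s a, s b} = 3" using ab(3) by simp
        moreover have "card (R - {a, b}) + 2 = t"
          using \<open>a \<noteq> b\<close> \<open>a \<in> R\<close> \<open>b \<in> R\<close> fR tR card_Diff_subset[of "{a, b}" R] card_mono[of R "{a, b}"]
          by auto
        ultimately show False by linarith
      qed
      have "card A \<le> card F + 1"
      proof (rule card_le_of_connecting_edges[OF fF _ fA])
        fix c :: "'a \<Rightarrow> 'a" and a b
        assume c: "\<And>p q. {p, q} \<in> F \<Longrightarrow> c p = c q" and ab: "a \<in> A" "b \<in> A"
        have eq: "c a = c b" if "a \<in> A" "b \<in> A" "s a \<noteq> s b" for a b
          using link[OF that] c by metis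
        show "c a = c b"
        proof (cases "s a = s b")
          case True
          then obtain d where "d \<in> A" "s d \<noteq> s a" using ab0 by metis
          then show ?thesis using eq[of a d] eq[of b d] ab True by metis
        qed (use eq ab in blast)
      qed (simp add: F_def)
      then show False using FA by simp
    next
      case False
      obtain a0 where a0: "a0 \<in> A" using FA by fastforce
      define z where "z = s a0"
      have z: "z \<in> S" "\<And>a. a \<in> A \<Longrightarrow> {a, z} \<in> E" using s a0 False unfolding z_def by metis+
      \<comment> \<open>All edges between \<open>R\<close> and \<open>S\<close> end in \<open>z\<close>, so the rest of \<open>S\<close> is reached only through \<open>z\<close>.\<close>
      have "\<exists>w\<in>S. {z, w} \<in> E"
      proof -
        have "\<not> S \<subseteq> {z}" using S2 card_mono[of "{z}" S] by auto
        then obtain y where y: "y \<in> S" "y \<noteq> z" by blast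
        have "y \<in> V" "z \<in> V" using y(1) z(1) V(2) by auto
        then obtain p where "path_between V E y p z" using G unfolding connected_graph_def by blast
        then obtain p1 q1 where pq: "{p1, q1} \<in> E" "p1 \<in> S - {z}" "q1 \<in> V - (S - {z})"
          by (rule path_crosses_boundary[where U = "S - {z}"]) (use y in auto)
        have "p1 \<notin> R" "p1 \<in> S" using pq dis by auto
        then have "q1 \<noteq> x" using pq V by (auto simp: R_iff insert_commute)
        moreover have "q1 \<notin> R"
        proof
          assume "q1 \<in> R"
          then have "q1 \<in> A" using pq by (auto simp: A_def insert_commute)
          then have "p1 = z" using uniq[of q1 p1] uniq[of q1 z] z pq by (auto simp: insert_commute)
          then show False using pq by simp
        qed
        ultimately have "q1 = z" using pq V by auto
        then show ?thesis using pq by (auto simp: insert_commute)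
      qed
      then obtain w where w: "w \<in> S" "{z, w} \<in> E" by blast
      have wz: "w \<noteq> z" using noloop w by auto
      \<comment> \<open>Otherwise \<open>{a, z}\<close> is connected and its boundary contains \<open>x\<close>, \<open>w\<close> and
          the other \<open>t - 1\<close> vertices of \<open>R\<close>.
          Distinct \<open>a\<close> thus have distinct missing edges, each with one end in \<open>A\<close> only.\<close>
      have "\<exists>y. y \<in> R - A \<and> {a, y} \<in> F" if a: "a \<in> A" for a
      proof (rule ccontr)
        assume no: "\<not> ?thesis"
        have aR: "a \<in> R" using a AR by blast
        have "connected_set E {a, z}"
          using connected_set_insert[OF connected_set_singleton, of z z a E] z a by simp
        moreover have "{a, z} \<subseteq> V" using aR z V by auto
        ultimately have le: "card (boundary V E {a, z}) \<le> t" by (rule bound)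
        have "y \<in> boundary V E {a, z}" if y: "y \<in> R - {a}" for y
        proof -
          have "{y, z} \<in> E \<or> {y, a} \<in> E"
            using no inF[of a y] y aR z(2)[of y] by (auto simp: insert_commute)
          then show ?thesis using y V z dis by (auto simp: boundary_def)
        qed
        moreover have "x \<in> boundary V E {a, z}"
          using aR x dis z by (auto simp: boundary_def R_iff)
        moreover have "w \<in> boundary V E {a, z}"
          using w V dis aR wz by (auto simp: boundary_def insert_commute)
        ultimately have "(R - {a}) \<union> {x, w} \<subseteq> boundary V E {a, z}" by auto
        then have "card ((R - {a}) \<union> {x, w}) \<le> t"
          using le card_mono[OF fB] order_trans by blast
        moreover have "card ((R - {a}) \<union> {x, w}) = card (R - {a}) + card {x, w}"
          using dis w fR by (intro card_Un_disjoint) auto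
        moreover have "x \<noteq> w" using dis(2) w(1) by auto
        then have "card {x, w} = 2" by simp
        moreover have "card (R - {a}) + 1 = t" using aR fR tR
          by (metis Suc_eq_plus1 card.remove)
        ultimately show False by linarith
      qed
      then obtain y where y: "\<And>a. a \<in> A \<Longrightarrow> y a \<in> R - A \<and> {a, y a} \<in> F" by metis
      have "inj_on (\<lambda>a. {a, y a}) A" using y by (fastforce simp: inj_on_def doubleton_eq_iff)
      moreover have "(\<lambda>a. {a, y a}) ` A \<subseteq> F" using y by auto
      ultimately have "card A \<le> card F" using card_inj_on_le[OF _ _ fF] by blast
      then show False using FA by simp
    qed
  qed
qed

section \<open>Very dense graphs\<close>

text \<open>No vertex is adjacent to both \<open>u\<close> and \<open>v\<close>, so there are no more edges at \<open>u\<close> or \<open>v\<close> than vertices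
  adjacent to one of them.\<close>

lemma card_edges_no_common_neighbour:
  assumes G: "connected_graph V E" and uv: "u \<in> V" "v \<in> V" "u \<noteq> v" "{u, v} \<notin> E"
    and no: "\<And>w. w \<in> V \<Longrightarrow> {u, w} \<in> E \<Longrightarrow> {w, v} \<notin> E"
  shows "card E + card {e. e \<subseteq> V - {u, v} \<and> card e = 2 \<and> e \<notin> E}
      \<le> ((card V - 2) choose 2) + card {w \<in> V. {u, w} \<in> E \<or> {v, w} \<in> E}"
    and "{w \<in> V. {u, w} \<in> E \<or> {v, w} \<in> E} \<subseteq> V - {u, v}"
proof -
  have fin: "finite V" and two: "\<And>e. e \<in> E \<Longrightarrow> card e = 2" and sub: "\<And>e. e \<in> E \<Longrightarrow> e \<subseteq> V"
    using G by (auto simp: connected_graph_def simple_graph_def)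
  have noloop: "{x, x} \<notin> E" for x using two[of "{x, x}"] by auto
  let ?W = "V - {u, v}"
  define X where "X = {w \<in> V. {u, w} \<in> E}"
  define Y where "Y = {w \<in> V. {v, w} \<in> E}"
  have XY: "{w \<in> V. {u, w} \<in> E \<or> {v, w} \<in> E} = X \<union> Y" by (auto simp: X_def Y_def)
  have dis: "X \<inter> Y = {}" using no by (auto simp: X_def Y_def insert_commute)
  have f: "finite X" "finite Y" using fin by (auto simp: X_def Y_def)
  show "{w \<in> V. {u, w} \<in> E \<or> {v, w} \<in> E} \<subseteq> ?W"
    using noloop uv by (auto simp: insert_commute)
  have "E \<subseteq> {e \<in> E. e \<subseteq> ?W} \<union> (\<lambda>w. {u, w}) ` X \<union> (\<lambda>w. {v, w}) ` Y"
  proof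
    fix e assume e: "e \<in> E"
    then obtain p q where pq: "e = {p, q}" using two[of e] by (auto simp: card_2_iff)
    have "p \<in> V" "q \<in> V" using sub[OF e] pq by auto
    then show "e \<in> {e \<in> E. e \<subseteq> ?W} \<union> (\<lambda>w. {u, w}) ` X \<union> (\<lambda>w. {v, w}) ` Y"
      using e pq by (auto simp: X_def Y_def image_iff insert_commute)
  qed
  then have "card E \<le> card ({e \<in> E. e \<subseteq> ?W} \<union> (\<lambda>w. {u, w}) ` X \<union> (\<lambda>w. {v, w}) ` Y)"
    using f fin by (intro card_mono) (auto intro: finite_subset[of _ "Pow V"])
  also have "\<dots> \<le> card {e \<in> E. e \<subseteq> ?W} + card ((\<lambda>w. {u, w}) ` X) + card ((\<lambda>w. {v, w}) ` Y)"
    by (meson add_mono_thms_linordered_semiring(3) card_Un_le order_trans)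
  also have "\<dots> \<le> card {e \<in> E. e \<subseteq> ?W} + card X + card Y"
    using card_image_le[OF f(1), of "\<lambda>w. {u, w}"] card_image_le[OF f(2), of "\<lambda>w. {v, w}"] by linarith
  finally have "card E \<le> card {e \<in> E. e \<subseteq> ?W} + card (X \<union> Y)"
    using card_Un_disjoint[OF f dis] by linarith
  moreover have "card ?W = card V - 2" using uv fin by (simp add: card_Diff_subset)
  moreover have "finite ?W" using fin by simp
  ultimately show "card E + card {e. e \<subseteq> ?W \<and> card e = 2 \<and> e \<notin> E}
      \<le> ((card V - 2) choose 2) + card {w \<in> V. {u, w} \<in> E \<or> {v, w} \<in> E}"
    unfolding XY using card_edges_plus_nonedges[of ?W E, OF _ two] by simp
qed

text \<open>Two nonadjacent vertices without common neighbour have at most \<open>card V - 2\<close> edges to the other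
  vertices, which leaves too few edges in total.\<close>

lemma mvc_ge_card_of_dense:
  assumes G: "connected_graph V E" and m: "card V + ((card V - 2) choose 2) \<le> card E + 1"
  shows "card V \<le> mvc V E"
proof (rule mvc_ge_card_of_diameter_two[OF G])
  fix u v assume uv: "u \<in> V" "v \<in> V" "u \<noteq> v" "{u, v} \<notin> E"
  have fin: "finite V" using G by (simp add: connected_graph_def simple_graph_def)
  show "\<exists>w\<in>V. {u, w} \<in> E \<and> {w, v} \<in> E"
  proof (rule ccontr)
    assume "\<not> ?thesis"
    then have no: "\<And>w. w \<in> V \<Longrightarrow> {u, w} \<in> E \<Longrightarrow> {w, v} \<notin> E" by blast
    have "card {w \<in> V. {u, w} \<in> E \<or> {v, w} \<in> E} \<le> card (V - {u, v})"
      using card_edges_no_common_neighbour(2)[OF G uv no] fin by (intro card_mono) auto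
    moreover have "card (V - {u, v}) + 2 = card V"
      using uv fin card_mono[of V "{u, v}"] by (simp add: card_Diff_subset)
    ultimately show False using card_edges_no_common_neighbour(1)[OF G uv no] m by linarith
  qed
qed

text \<open>It suffices to find a dominating edge if some nonadjacent \<open>u\<close> and \<open>v\<close> have no common neighbour. If
  there is none, every neighbour \<open>x\<close> of \<open>u\<close> and every neighbour \<open>y\<close> of \<open>v\<close> are nonadjacent or have a
  common non-neighbour other than \<open>u\<close> and \<open>v\<close>. Then the missing edges outside \<open>{u, v}\<close> connect all
  neighbours of \<open>u\<close> and \<open>v\<close>, so the edges at \<open>u\<close> and \<open>v\<close> outnumber them by at most one.\<close>

lemma mvc_ge_card_minus_one_of_dense:
  assumes G: "connected_graph V E" and n: "3 \<le> card V"
    and m: "card V + ((card V - 3) choose 2) \<le> card E + 1"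
  shows "card V \<le> mvc V E + 1"
proof (cases "\<forall>u\<in>V. \<forall>v\<in>V. u \<noteq> v \<longrightarrow> {u, v} \<notin> E \<longrightarrow> (\<exists>w\<in>V. {u, w} \<in> E \<and> {w, v} \<in> E)")
  case True
  then have "card V \<le> mvc V E" by (intro mvc_ge_card_of_diameter_two[OF G]) blast
  then show ?thesis by simp
next
  case False
  then obtain u v where uv: "u \<in> V" "v \<in> V" "u \<noteq> v" "{u, v} \<notin> E"
    and no: "\<And>w. w \<in> V \<Longrightarrow> {u, w} \<in> E \<Longrightarrow> {w, v} \<notin> E" by blast
  have fin: "finite V" and two: "\<And>e. e \<in> E \<Longrightarrow> card e = 2" and sub: "\<And>e. e \<in> E \<Longrightarrow> e \<subseteq> V"
    using G by (auto simp: connected_graph_def simple_graph_def)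
  define A where "A = {w \<in> V. {u, w} \<in> E \<or> {v, w} \<in> E}"
  define F where "F = {e. e \<subseteq> V - {u, v} \<and> card e = 2 \<and> e \<notin> E}"
  have AW: "A \<subseteq> V - {u, v}" using card_edges_no_common_neighbour(2)[OF G uv no] by (simp add: A_def)
  have fA: "finite A" and fF: "finite F"
    using fin by (auto simp: A_def F_def intro: finite_subset[of _ "Pow V"])
  have inF: "{p, q} \<in> F" if "p \<in> V - {u, v}" "q \<in> V - {u, v}" "p \<noteq> q" "{p, q} \<notin> E" for p q
    using that by (auto simp: F_def)
  have exists_nbr: "\<exists>x\<in>V. {a, x} \<in> E" if ab: "a \<in> V" "b \<in> V" "a \<noteq> b" for a b
  proof -
    obtain p where "path_between V E a p b" using G ab unfolding connected_graph_def by blast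
    then obtain a' x where "{a', x} \<in> E" "a' \<in> {a}" "x \<in> V - {a}"
      by (rule path_crosses_boundary[where U = "{a}"]) (use ab in auto)
    then show ?thesis by auto
  qed
  obtain x0 where x0: "x0 \<in> V" "{u, x0} \<in> E" using exists_nbr[of u v] uv by blast
  obtain y0 where y0: "y0 \<in> V" "{v, y0} \<in> E" using exists_nbr[of v u] uv by blast
  show ?thesis
  proof (rule ccontr)
    assume small: "\<not> ?thesis"
    have link: "{x, y} \<in> F \<or> (\<exists>z. {x, z} \<in> F \<and> {z, y} \<in> F)"
      if x: "x \<in> V" "{u, x} \<in> E" and y: "y \<in> V" "{v, y} \<in> E" for x y
    proof (rule ccontr)
      assume none: "\<not> ?thesis"
      have W: "x \<in> V - {u, v}" "y \<in> V - {u, v}" using x y AW by (auto simp: A_def)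
      have "x \<noteq> y" using no[of x] x y by (auto simp: insert_commute)
      then have xy: "{x, y} \<in> E" using none inF[OF W] by blast
      have conn: "connected_set E {x, y}"
        using connected_set_insert[OF connected_set_singleton, of y y x E] xy by simp
      have "z \<in> boundary V E {x, y}" if z: "z \<in> V - {x, y}" for z
      proof -
        consider "z = u" | "z = v" | "z \<in> V - {u, v}" using z by blast
        then have "{z, x} \<in> E \<or> {z, y} \<in> E"
        proof cases
          case 3
          then have "{x, z} \<in> E \<or> {z, y} \<in> E" using none inF[of x z] inF[of z y] W z by blast
          then show ?thesis by (simp add: insert_commute)
        qed (use x y in \<open>auto simp: insert_commute\<close>)
        then show ?thesis using z by (auto simp: boundary_def)
      qed
      then have "card (V - {x, y}) \<le> card (boundary V E {x, y})"
        using fin by (intro card_mono) (auto simp: boundary_def)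
      moreover have "card (V - {x, y}) + 2 = card V"
        using \<open>x \<noteq> y\<close> W fin n by (simp add: card_Diff_subset)
      moreover have "{x, y} \<subseteq> V" using W by blast
      ultimately show False using mvc_gt_card_boundary[OF G conn] small by linarith
    qed
    have "card A \<le> card F + 1"
    proof (rule card_le_of_connecting_edges[OF fF _ fA])
      fix c :: "'a \<Rightarrow> 'a" and a b
      assume c: "\<And>p q. {p, q} \<in> F \<Longrightarrow> c p = c q" and ab: "a \<in> A" "b \<in> A"
      have eq: "c x = c y" if "x \<in> V" "{u, x} \<in> E" "y \<in> V" "{v, y} \<in> E" for x y
        using link[OF that] c by metis
      have "c a = c x0" if "a \<in> A" for a
      proof (cases "{u, a} \<in> E")
        case True
        then have "c a = c y0" using eq[of a y0] that y0 by (simp add: A_def)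
        moreover have "c x0 = c y0" using eq[of x0 y0] x0 y0 by blast
        ultimately show ?thesis by simp
      next
        case False
        then show ?thesis using eq[of x0 a] that x0 by (simp add: A_def)
      qed
      then show "c a = c b" using ab by metis
    qed (simp add: F_def)
    moreover have "card E + card F \<le> ((card V - 2) choose 2) + card A"
      using card_edges_no_common_neighbour(1)[OF G uv no] by (simp add: A_def F_def)
    moreover have "(card V - 2) choose 2 = (card V - 3) + ((card V - 3) choose 2)"
    proof -
      have "card V - 2 = Suc (card V - 3)" using n by simp
      then show ?thesis by (simp add: numeral_2_eq_2)
    qed
    ultimately show False using m n by linarith
  qed
qed

section \<open>Sharpness\<close>

lemma connected_graph_forward_edges:
  assumes "1 \<le> n" and E: "\<And>e. e \<in> E \<Longrightarrow> e \<subseteq> {0..<n} \<and> card e = 2"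
    and fwd: "\<And>v. v < n - 1 \<Longrightarrow> \<exists>w. v < w \<and> w < n \<and> {v, w} \<in> E"
  shows "connected_graph {0..<n::nat} E"
  unfolding connected_graph_iff
proof
  show "simple_graph {0..<n} E" using E by (simp add: simple_graph_def)
  show "connected_set E {0..<n}"
  proof (rule connected_set_from_root[of "n - 1"])
    show "n - 1 \<in> {0..<n}" using assms(1) by simp
    fix v assume "v \<in> {0..<n}"
    then show "\<exists>p. path_between {0..<n} E v p (n - 1)"
    proof (induction "n - v" arbitrary: v rule: less_induct)
      case less
      show ?case
      proof (cases "v = n - 1")
        case True
        then show ?thesis using path_between_refl less.prems by metis
      next
        case False
        then have "v < n - 1" using less.prems by auto
        then obtain w where w: "v < w" "w < n" "{v, w} \<in> E" using fwd by blast
        then have "n - w < n - v" by simp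
        then obtain p where "path_between {0..<n} E w p (n - 1)" using less.hyps[of w] w(2) by auto
        moreover have "path_between {0..<n} E v [v, w] w"
          using w by (intro path_between_edge) auto
        ultimately show ?thesis using path_between_trans by metis
      qed
    qed
  qed
qed

text \<open>The edges from each vertex \<open>v\<close> to \<open>p v > v\<close> form a spanning tree rooted at \<open>n - 1\<close>; every edge set
  between this tree and \<open>E\<close> is connected.\<close>

lemma exists_connected_subgraph:
  assumes n: "1 \<le> n" and E: "\<And>e. e \<in> E \<Longrightarrow> e \<subseteq> {0..<n::nat} \<and> card e = 2"
    and fwd: "\<And>v. v < n - 1 \<Longrightarrow> v < p v \<and> p v < n \<and> {v, p v} \<in> E"
    and m: "n - 1 \<le> m" "m \<le> card E"
  shows "\<exists>E'\<subseteq>E. connected_graph {0..<n} E' \<and> card E' = m"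
proof -
  let ?T = "(\<lambda>v. {v, p v}) ` {0..<n - 1}"
  have "card ?T \<le> n - 1" using card_image_le[of "{0..<n - 1}" "\<lambda>v. {v, p v}"] by simp
  moreover have "?T \<subseteq> E" using fwd by auto
  moreover have "finite E" using E by (auto intro: finite_subset[of _ "Pow {0..<n}"])
  ultimately obtain E' where E': "?T \<subseteq> E'" "E' \<subseteq> E" "card E' = m"
    using exists_subset_between[of ?T m E] m by auto
  have "connected_graph {0..<n} E'"
  proof (rule connected_graph_forward_edges[OF n])
    fix v assume v: "v < n - 1"
    then have "{v, p v} \<in> E'" using E'(1) by auto
    then show "\<exists>w. v < w \<and> w < n \<and> {v, w} \<in> E'" using fwd[OF v] by blast
  qed (use E E' in auto)
  then show ?thesis using E' by blast
qed

lemma exists_connected_graph: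
  assumes "1 \<le> n" and "n - 1 \<le> m" and "m \<le> n choose 2"
  shows "\<exists>(V :: nat set) E. connected_graph V E \<and> card V = n \<and> card E = m"
proof -
  let ?E = "{e. e \<subseteq> {0..<n} \<and> card e = 2}"
  have "card ?E = n choose 2" using n_subsets[of "{0..<n}" 2] by simp
  then have "\<exists>E'\<subseteq>?E. connected_graph {0..<n} E' \<and> card E' = m"
    using assms by (intro exists_connected_subgraph[of n ?E Suc m]) auto
  then obtain E' where "connected_graph {0..<n} E'" "card E' = m" by blast
  then show ?thesis by (intro exI[of _ "{0..<n}"] exI[of _ E']) simp
qed

text \<open>The vertices are arranged in \<open>n - t + 1\<close> layers \<open>{0}\<close>, \<open>{1..t}\<close>, \<open>{t + 1}\<close>, \<open>{t + 2}\<close>, and so on up to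
  \<open>{n - 1}\<close>, and edges join vertices of the same or of consecutive layers. There are
  \<open>n + ((t + 1) choose 2) - 2\<close> such pairs. A monochromatic path from \<open>0\<close> to \<open>n - 1\<close> meets every layer
  between, so the vertices \<open>t + 1, ..., n - 2\<close> all have the colour of some vertex of \<open>{1..t}\<close>, and at most \<open>t + 2\<close>
  colours remain.\<close>

lemma exists_layered_graph:
  assumes t: "1 \<le> t" "t + 3 \<le> n" and m: "n - 1 \<le> m" "m + 2 \<le> n + ((t + 1) choose 2)"
  shows "\<exists>(V :: nat set) E. connected_graph V E \<and> card V = n \<and> card E = m \<and> mvc V E \<le> t + 2"
proof -
  define lev where "lev v = (if v = 0 then 0 else if v \<le> t then 1 else v - t + 1)" for v :: nat
  define E where "E = {e. e \<subseteq> {0..<n} \<and> card e = 2 \<and> (\<forall>a\<in>e. \<forall>b\<in>e. lev b \<le> lev a + 1)}"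
  define p where "p v = (if v = 0 then 1 else if v \<le> t then t + 1 else v + 1)" for v :: nat
  have "m \<le> card E"
  proof -
    let ?A = "{e. e \<subseteq> {0..t} \<and> card e = 2}"
    let ?B = "(\<lambda>v. {v, t + 1}) ` {1..t}" and ?C = "(\<lambda>v. {v, v + 1}) ` {t + 1..<n - 1}"
    have "card ?A = (t + 1) choose 2" using n_subsets[of "{0..t}" 2] by simp
    moreover have "card ?B = t" by (subst card_image) (auto simp: inj_on_def doubleton_eq_iff)
    moreover have "card ?C = n - 1 - (t + 1)"
      by (subst card_image) (auto simp: inj_on_def doubleton_eq_iff)
    moreover have "finite ?A" by (auto intro: finite_subset[of _ "Pow {0..t}"])
    moreover have "?A \<inter> ?B = {}" "(?A \<union> ?B) \<inter> ?C = {}" by (auto simp: doubleton_eq_iff)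
    ultimately have "card (?A \<union> ?B \<union> ?C) = ((t + 1) choose 2) + t + (n - 1 - (t + 1))"
      by (subst card_Un_disjoint, simp, simp, simp, subst card_Un_disjoint) auto
    moreover have "?A \<union> ?B \<union> ?C \<subseteq> E" using t by (auto simp: E_def lev_def)
    moreover have "finite E" by (auto simp: E_def intro: finite_subset[of _ "Pow {0..<n}"])
    ultimately have "((t + 1) choose 2) + t + (n - 1 - (t + 1)) \<le> card E"
      using card_mono[of E "?A \<union> ?B \<union> ?C"] by simp
    then show ?thesis using m t by linarith
  qed
  moreover have "v < p v \<and> p v < n \<and> {v, p v} \<in> E" if "v < n - 1" for v
    using that t by (auto simp: p_def E_def lev_def)
  ultimately obtain E' where E': "E' \<subseteq> E" "connected_graph {0..<n} E'" "card E' = m"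
    using exists_connected_subgraph[of n E p m] t m by (auto simp: E_def)
  have "mvc {0..<n} E' \<le> t + 2"
  proof (rule mvc_leI[OF E'(2)])
    fix c assume c: "MVC_coloring {0..<n} E' c"
    obtain q where q: "path_between {0..<n} E' 0 q (n - 1)" "vertex_monochromatic c q"
      using t bspec[OF bspec[OF c[unfolded MVC_coloring_def], of 0], of "n - 1"] by auto
    have cross: "\<exists>b\<in>internal_vertices q. lev b = l" if l: "1 \<le> l" "l < lev (n - 1)" for l
    proof -
      have "0 \<in> {v. lev v < l}" "n - 1 \<notin> {v. lev v < l}" using l by (auto simp: lev_def)
      then obtain a b where ab: "{a, b} \<in> E'" "lev a < l" "\<not> lev b < l"
        "b = n - 1 \<or> b \<in> internal_vertices q"
        using path_crosses_boundary[OF q(1), of "{v. lev v < l}"] by (metis DiffD2 mem_Collect_eq)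
      then have "lev b \<le> lev a + 1" using E'(1) by (auto simp: E_def)
      then have "lev b = l" using ab by simp
      then show ?thesis using ab(4) l by auto
    qed
    have "1 < lev (n - 1)" using t by (simp add: lev_def)
    then obtain b where b: "b \<in> internal_vertices q" "lev b = 1" using cross[of 1] by auto
    then have bt: "b \<in> {0..t}" by (auto simp: lev_def split: if_splits)
    have path_colour: "c v = c b" if v: "v \<in> {t + 1..<n - 1}" for v
    proof -
      have "1 \<le> lev v" "lev v < lev (n - 1)" using v by (auto simp: lev_def)
      then obtain b' where b': "b' \<in> internal_vertices q" "lev b' = lev v" using cross by blast
      then have "b' = v" using v by (auto simp: lev_def split: if_splits)
      then show ?thesis using b(1) b'(1) q(2) unfolding vertex_monochromatic_def by blast
    qed
    have "c ` {0..<n} \<subseteq> c ` insert (n - 1) {0..t}"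
    proof (intro image_subsetI)
      fix v assume "v \<in> {0..<n}"
      then consider "v \<in> insert (n - 1) {0..t}" | "v \<in> {t + 1..<n - 1}" by fastforce
      then show "c v \<in> c ` insert (n - 1) {0..t}"
      proof cases
        case 2
        then show ?thesis using path_colour bt by auto
      qed auto
    qed
    then have "card (c ` {0..<n}) \<le> card (c ` insert (n - 1) {0..t})" by (intro card_mono) auto
    also have "\<dots> \<le> card (insert (n - 1) {0..t})" by (intro card_image_le) auto
    also have "\<dots> \<le> t + 2" by (simp add: card_insert_if)
    finally show "card (c ` {0..<n}) \<le> t + 2" .
  qed
  then show ?thesis using E' by (intro exI[of _ "{0..<n}"] exI[of _ E']) simp
qed

text \<open>The graph is the complete graph on \<open>t + 2\<close> vertices with one edge replaced by the path
  \<open>0, 1, ..., L\<close>; \<open>W\<close> is the set of the other \<open>t\<close> vertices of the clique, all adjacent to both \<open>0\<close> and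
  \<open>L\<close>. Let the colour be constant on the prefix \<open>0..\<alpha>\<close> and on the suffix \<open>\<beta>..L\<close>, with \<open>\<alpha>\<close> maximal and
  \<open>\<beta>\<close> minimal. A monochromatic path from \<open>W\<close> to an inner vertex \<open>k\<close> runs along all of one side of \<open>k\<close>,
  which forces \<open>\<beta> \<le> \<alpha> + 3\<close>. So besides the colours on \<open>W\<close> there are at most four: those of \<open>0\<close>, \<open>L\<close>,
  \<open>\<alpha> + 1\<close> and \<open>\<alpha> + 2\<close>. A monochromatic path between the ends of a short segment whose interior has
  two colours must go around through \<open>W\<close>, which identifies the colour of \<open>0\<close> or \<open>L\<close> with one on \<open>W\<close>.
  This saves enough colours if \<open>L \<ge> 4\<close>, which is what \<open>n \<ge> t + 5\<close> means.\<close>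

lemma exists_subdivided_clique:
  assumes t: "1 \<le> t" "t + 5 \<le> n"
  shows "\<exists>(V :: nat set) E. connected_graph V E \<and> card V = n
    \<and> card E + 1 = n + ((t + 1) choose 2) \<and> mvc V E \<le> t + 2"
proof -
  define L where "L = n - t - 1"
  define W where "W = {L + 1..<n}"
  have L: "4 \<le> L" "L + 1 < n" and cW: "card W = t" and fW: "finite W"
    using t by (auto simp: L_def W_def)
  define P where "P = (\<lambda>i. {i, i + 1}) ` {0..<L}"
  define A where "A = (\<lambda>w. {0, w}) ` W"
  define B where "B = (\<lambda>w. {L, w}) ` W"
  define C where "C = {e. e \<subseteq> W \<and> card e = 2}"
  define E where "E = P \<union> A \<union> B \<union> C"
  have E2: "e \<subseteq> {0..<n} \<and> card e = 2" if "e \<in> E" for e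
    using that L by (auto simp: E_def P_def A_def B_def C_def W_def)
  have fwd: "{v, v + 1} \<in> E" if "v < n - 1" for v
  proof -
    consider "v < L" | "v = L" | "L < v" by linarith
    then show ?thesis using L that by cases (auto simp: E_def P_def B_def C_def W_def)
  qed
  have G: "connected_graph {0..<n} E"
  proof (rule connected_graph_forward_edges)
    fix v assume "v < n - 1"
    then show "\<exists>w. v < w \<and> w < n \<and> {v, w} \<in> E" using fwd[of v] by (intro exI[of _ "v + 1"]) auto
  qed (use L E2 in auto)
  have cE: "card E + 1 = n + ((t + 1) choose 2)"
  proof -
    have "card P = L" by (simp add: P_def card_image inj_on_def doubleton_eq_iff)
    moreover have "card A = t" "card B = t"
      by (simp_all add: A_def B_def card_image inj_on_def doubleton_eq_iff cW)
    moreover have "card C = t choose 2" using n_subsets[OF fW, of 2] cW by (simp add: C_def)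
    moreover have "P \<inter> A = {}" "(P \<union> A) \<inter> B = {}" "(P \<union> A \<union> B) \<inter> C = {}"
      using L by (auto simp: P_def A_def B_def C_def W_def doubleton_eq_iff)
    moreover have "finite P" "finite A" "finite B" "finite C"
      using fW by (auto simp: P_def A_def B_def C_def intro: finite_subset[of _ "Pow W"])
    ultimately have "card E = L + t + t + (t choose 2)"
      by (simp add: E_def card_Un_disjoint)
    moreover have "(t + 1) choose 2 = t + (t choose 2)" by (simp add: numeral_2_eq_2)
    ultimately show ?thesis using t by (simp add: L_def)
  qed
  have nbr: "a < L \<and> b = a + 1 \<or> a = b + 1 \<or> (a = 0 \<or> a = L) \<and> b \<in> W"
    if "{a, b} \<in> E" "a \<le> L" for a b
    using that by (auto simp: E_def P_def A_def B_def C_def W_def doubleton_eq_iff)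
  have "mvc {0..<n} E \<le> t + 2"
  proof (rule mvc_leI[OF G])
    fix c assume "MVC_coloring {0..<n} E c"
    then have path: "\<exists>p. path_between {0..<n} E u p v \<and> vertex_monochromatic c p"
      if "u < n" "v < n" for u v using that by (auto simp: MVC_coloring_def)
    \<comment> \<open>If the path missed \<open>i < k\<close> and \<open>i' > k\<close>, it could not enter the segment between
        them, which contains \<open>k\<close>.\<close>
    have one_side: "(\<forall>i<k. c i = c 0) \<or> (\<forall>i. k < i \<and> i \<le> L \<longrightarrow> c i = c L)"
      if k: "0 < k" "k < L" for k
    proof -
      obtain p where p: "path_between {0..<n} E (L + 1) p k" "vertex_monochromatic c p"
        using path[of "L + 1" k] k L by auto
      have "i \<in> internal_vertices p \<or> i' \<in> internal_vertices p" if i: "i < k" "k < i'" "i' \<le> L" for i i'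
      proof -
        obtain a b where ab: "{a, b} \<in> E" "a \<in> - {i<..<i'}" "b \<in> {0..<n} - (- {i<..<i'})"
          "a = L + 1 \<or> a \<in> internal_vertices p"
          by (rule path_crosses_boundary[OF p(1), of "- {i<..<i'}"]) (use i in auto)
        have "b \<le> L" "0 < b" "b < L" using ab(3) i by auto
        then have "a = b + 1 \<or> b = a + 1" using nbr[of b a] ab(1) by (auto simp: insert_commute)
        then have "(a = i \<or> a = i') \<and> a \<noteq> L + 1" using ab(2,3) i by auto
        then show ?thesis using ab(4) by auto
      qed
      then consider "\<forall>i<k. i \<in> internal_vertices p" | "\<forall>i. k < i \<and> i \<le> L \<longrightarrow> i \<in> internal_vertices p"
        by blast
      then show ?thesis using p(2) k unfolding vertex_monochromatic_def by cases blast+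
    qed
    \<comment> \<open>If the path misses some \<open>k\<close> between \<open>x\<close> and \<open>y\<close>, it has to run over all vertices below \<open>x\<close>, through \<open>W\<close>, and
        over all vertices above \<open>y\<close>.\<close>
    have inside_or_around: "(\<forall>i j. x < i \<and> i < y \<and> x < j \<and> j < y \<longrightarrow> c i = c j)
        \<or> (\<exists>w\<in>W. \<forall>i\<le>L. i < x \<or> y < i \<longrightarrow> c i = c w)" if xy: "x < y" "y \<le> L" for x y
    proof -
      obtain p where p: "path_between {0..<n} E x p y" "vertex_monochromatic c p"
        using path[of x y] xy L by auto
      show ?thesis
      proof (cases "\<forall>i. x < i \<and> i < y \<longrightarrow> i \<in> internal_vertices p")
        case True
        then show ?thesis using p(2) unfolding vertex_monochromatic_def by blast
      next
        case False
        then obtain k where k: "x < k" "k < y" "k \<notin> internal_vertices p" by blast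
        have left: "i \<in> internal_vertices p" if i: "i < x" for i
        proof -
          obtain a b where ab: "{a, b} \<in> E" "a \<in> {i<..<k}" "b \<in> {0..<n} - {i<..<k}"
            "b = y \<or> b \<in> internal_vertices p"
            by (rule path_crosses_boundary[OF p(1), of "{i<..<k}"]) (use i k in auto)
          have "a \<le> L" "0 < a" "a < L" using ab(2) k xy by auto
          then have "a = b + 1 \<or> b = a + 1" using nbr[of a b] ab(1) by auto
          then have "b = i \<or> b = k" using ab(2,3) by auto
          then show ?thesis using ab(4) k i xy by auto
        qed
        have right: "i \<in> internal_vertices p" if i: "y < i" "i \<le> L" for i
        proof -
          obtain a b where ab: "{a, b} \<in> E" "a \<in> - {k<..<i}" "b \<in> {0..<n} - (- {k<..<i})"
            "a = x \<or> a \<in> internal_vertices p"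
            by (rule path_crosses_boundary[OF p(1), of "- {k<..<i}"]) (use i k in auto)
          have "b \<le> L" "0 < b" "b < L" using ab(3) i by auto
          then have "a = b + 1 \<or> b = a + 1" using nbr[of b a] ab(1) by (auto simp: insert_commute)
          then have "a = k \<or> a = i" using ab(2,3) by auto
          then show ?thesis using ab(4) k i xy by auto
        qed
        obtain a b where ab: "{a, b} \<in> E" "a \<in> {..<k}" "b \<in> {0..<n} - {..<k}"
          "b = y \<or> b \<in> internal_vertices p"
          by (rule path_crosses_boundary[OF p(1), of "{..<k}"]) (use k in auto)
        have "a < L" using ab(2) k xy by auto
        then have "b = k \<or> b \<in> W" using nbr[of a b] ab(1,2,3) by auto
        then have b: "b \<in> W" "b \<in> internal_vertices p" using ab(4) k xy by (auto simp: W_def)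
        then have "\<forall>i\<le>L. i < x \<or> y < i \<longrightarrow> c i = c b"
          using left right p(2) unfolding vertex_monochromatic_def by blast
        then show ?thesis using b by blast
      qed
    qed
    have bound: "card (c ` {0..<n}) \<le> t + 2"
      if cover: "\<And>i. i \<le> L \<Longrightarrow> c i \<in> c ` W \<union> {a, b}" for a b
    proof -
      have "c ` {0..<n} \<subseteq> c ` W \<union> {a, b}"
      proof (intro image_subsetI)
        fix i assume "i \<in> {0..<n}"
        then show "c i \<in> c ` W \<union> {a, b}" using cover[of i] by (cases "i \<le> L") (auto simp: W_def)
      qed
      then have "card (c ` {0..<n}) \<le> card (c ` W \<union> {a, b})" using fW by (intro card_mono) auto
      also have "\<dots> \<le> card (c ` W) + card {a, b}" by (rule card_Un_le)
      also have "\<dots> \<le> t + 2"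
        using card_image_le[OF fW, of c] cW by (simp add: card_insert_if)
      finally show ?thesis .
    qed
    define \<alpha> where "\<alpha> = (GREATEST a. a \<le> L \<and> (\<forall>i\<le>a. c i = c 0))"
    define \<beta> where "\<beta> = (LEAST b. b \<le> L \<and> (\<forall>i. b \<le> i \<and> i \<le> L \<longrightarrow> c i = c L))"
    have "\<alpha> \<le> L \<and> (\<forall>i\<le>\<alpha>. c i = c 0)"
      unfolding \<alpha>_def by (rule GreatestI_nat[of _ 0 L]) auto
    then have \<alpha>: "\<alpha> \<le> L" "\<And>i. i \<le> \<alpha> \<Longrightarrow> c i = c 0" by blast+
    have \<alpha>_max: "a \<le> \<alpha>" if "a \<le> L" "\<And>i. i \<le> a \<Longrightarrow> c i = c 0" for a
      unfolding \<alpha>_def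
      by (rule Greatest_le_nat[of "\<lambda>a. a \<le> L \<and> (\<forall>i\<le>a. c i = c 0)" a L]) (use that in blast)+
    have "\<beta> \<le> L \<and> (\<forall>i. \<beta> \<le> i \<and> i \<le> L \<longrightarrow> c i = c L)"
      unfolding \<beta>_def by (rule LeastI[of _ L]) auto
    then have \<beta>: "\<beta> \<le> L" "\<And>i. \<beta> \<le> i \<Longrightarrow> i \<le> L \<Longrightarrow> c i = c L" by blast+
    have \<beta>_min: "\<beta> \<le> b" if "b \<le> L" "\<And>i. b \<le> i \<Longrightarrow> i \<le> L \<Longrightarrow> c i = c L" for b
      unfolding \<beta>_def by (rule Least_le) (use that in blast)
    have \<alpha>_next: "c (\<alpha> + 1) \<noteq> c 0" if "\<alpha> < L"
    proof
      assume "c (\<alpha> + 1) = c 0"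
      then have "c i = c 0" if "i \<le> \<alpha> + 1" for i
        using \<alpha>(2)[of i] that by (cases "i = \<alpha> + 1") auto
      moreover have "\<alpha> + 1 \<le> L" using that by simp
      ultimately have "\<alpha> + 1 \<le> \<alpha>" using \<alpha>_max by blast
      then show False by simp
    qed
    have \<beta>_prev: "c (\<beta> - 1) \<noteq> c L" if "0 < \<beta>"
    proof
      assume eq: "c (\<beta> - 1) = c L"
      have "c i = c L" if "\<beta> - 1 \<le> i" "i \<le> L" for i
        using that eq \<beta>(2)[of i] by (cases "i = \<beta> - 1") auto
      moreover have "\<beta> - 1 \<le> L" using \<beta>(1) by simp
      ultimately have "\<beta> \<le> \<beta> - 1" using \<beta>_min by blast
      then show False using that by simp
    qed
    show "card (c ` {0..<n}) \<le> t + 2"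
    proof (cases "\<beta> \<le> \<alpha> + 1")
      case True
      show ?thesis
      proof (rule bound[of "c 0" "c L"])
        fix i assume "i \<le> L"
        then show "c i \<in> c ` W \<union> {c 0, c L}"
          using \<alpha>(2)[of i] \<beta>(2)[of i] True by (cases "i \<le> \<alpha>") auto
      qed
    next
      case False
      then have lt: "\<alpha> + 2 \<le> \<beta>" "\<alpha> + 2 \<le> L" "\<alpha> < L" "0 < \<beta>" using \<beta>(1) by auto
      have \<beta>3: "\<beta> \<le> \<alpha> + 3"
      proof (cases "\<alpha> + 2 < L")
        case True
        have pos: "0 < \<alpha> + 2" and "\<alpha> + 1 < \<alpha> + 2" by simp_all
        then have "\<not> (\<forall>i<\<alpha> + 2. c i = c 0)" using \<alpha>_next lt(3) by blast
        then have suffix: "\<forall>i. \<alpha> + 2 < i \<and> i \<le> L \<longrightarrow> c i = c L"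
          using one_side[OF pos True] by blast
        show ?thesis
        proof (rule \<beta>_min)
          fix i assume "\<alpha> + 3 \<le> i" "i \<le> L"
          then have "\<alpha> + 2 < i \<and> i \<le> L" by simp
          then show "c i = c L" using suffix by blast
        qed (use True in simp)
      qed (use \<beta>(1) in simp)
      \<comment> \<open>The segments \<open>\<alpha> - 1, ..., \<alpha> + 2\<close> and \<open>\<beta> - 2, ..., \<beta> + 1\<close> have two differently coloured inner
          vertices, by the choice of \<open>\<alpha>\<close> and \<open>\<beta>\<close>.\<close>
      have nearleft: "\<exists>w\<in>W. \<forall>i\<le>L. i < \<alpha> - 1 \<or> \<alpha> + 2 < i \<longrightarrow> c i = c w" if "1 \<le> \<alpha>"
      proof -
        have "\<not> (\<forall>i j. \<alpha> - 1 < i \<and> i < \<alpha> + 2 \<and> \<alpha> - 1 < j \<and> j < \<alpha> + 2 \<longrightarrow> c i = c j)"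
        proof
          assume eq: "\<forall>i j. \<alpha> - 1 < i \<and> i < \<alpha> + 2 \<and> \<alpha> - 1 < j \<and> j < \<alpha> + 2 \<longrightarrow> c i = c j"
          have "c (\<alpha> + 1) = c \<alpha>" by (rule eq[rule_format]) (use that in simp)
          then show False using \<alpha>_next[OF lt(3)] \<alpha>(2)[of \<alpha>] by simp
        qed
        moreover have "\<alpha> - 1 < \<alpha> + 2" by simp
        ultimately show ?thesis using inside_or_around[OF _ lt(2), of "\<alpha> - 1"] by blast
      qed
      have nearright: "\<exists>w\<in>W. \<forall>i\<le>L. i < \<beta> - 2 \<or> \<beta> + 1 < i \<longrightarrow> c i = c w" if "\<beta> + 1 \<le> L"
      proof -
        have "\<not> (\<forall>i j. \<beta> - 2 < i \<and> i < \<beta> + 1 \<and> \<beta> - 2 < j \<and> j < \<beta> + 1 \<longrightarrow> c i = c j)"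
        proof
          assume eq: "\<forall>i j. \<beta> - 2 < i \<and> i < \<beta> + 1 \<and> \<beta> - 2 < j \<and> j < \<beta> + 1 \<longrightarrow> c i = c j"
          have "c (\<beta> - 1) = c \<beta>" by (rule eq[rule_format]) (use lt in linarith)
          then show False using \<beta>_prev[OF lt(4)] \<beta>(2)[of \<beta>] \<beta>(1) by simp
        qed
        moreover have "\<beta> - 2 < \<beta> + 1" by simp
        ultimately show ?thesis using inside_or_around[OF _ that, of "\<beta> - 2"] by blast
      qed
      show ?thesis
      proof (cases "\<beta> = \<alpha> + 3 \<and> c (\<alpha> + 1) \<noteq> c (\<alpha> + 2)")
        case True
        have "\<not> (\<forall>i j. \<alpha> < i \<and> i < \<alpha> + 3 \<and> \<alpha> < j \<and> j < \<alpha> + 3 \<longrightarrow> c i = c j)"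
        proof
          assume eq: "\<forall>i j. \<alpha> < i \<and> i < \<alpha> + 3 \<and> \<alpha> < j \<and> j < \<alpha> + 3 \<longrightarrow> c i = c j"
          have "c (\<alpha> + 1) = c (\<alpha> + 2)" by (rule eq[rule_format]) simp
          then show False using True by simp
        qed
        moreover have "\<alpha> < \<alpha> + 3" "\<alpha> + 3 \<le> L" using True \<beta>(1) by auto
        ultimately obtain w where w: "w \<in> W" "\<And>i. i \<le> L \<Longrightarrow> i < \<alpha> \<or> \<alpha> + 3 < i \<Longrightarrow> c i = c w"
          using inside_or_around by blast
        \<comment> \<open>Four colours may occur on the path, so both \<open>c 0\<close> and \<open>c L\<close> must be shown to
            occur on \<open>W\<close>; when \<open>0\<close> or \<open>L\<close>
            is an end of the segment \<open>\<alpha>, ..., \<alpha> + 3\<close>, a shifted segment is used for it.\<close>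
        have first: "c 0 \<in> c ` W"
        proof (cases "\<alpha> = 0")
          case \<alpha>0: True
          then have "\<beta> + 1 \<le> L" "0 < \<beta> - 2" using True L by auto
          then obtain w' where "w' \<in> W" "c 0 = c w'" using nearright by blast
          then show ?thesis by simp
        next
          case False
          then show ?thesis using w(1) w(2)[of 0] by simp
        qed
        have last: "c L \<in> c ` W"
        proof (cases "\<alpha> + 3 < L")
          case False
          then have "1 \<le> \<alpha>" "\<alpha> + 2 < L" using L True \<beta>(1) by auto
          then obtain w' where "w' \<in> W" "c L = c w'" using nearleft by blast
          then show ?thesis by simp
        next
          case True
          then show ?thesis using w(1) w(2)[of L] by simp
        qed
        show ?thesis
        proof (rule bound[of "c (\<alpha> + 1)" "c (\<alpha> + 2)"])
          fix i assume i: "i \<le> L"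
          consider "i \<le> \<alpha>" | "i = \<alpha> + 1" | "i = \<alpha> + 2" | "\<beta> \<le> i" using True by linarith
          then show "c i \<in> c ` W \<union> {c (\<alpha> + 1), c (\<alpha> + 2)}"
          proof cases
            case 1
            then show ?thesis using \<alpha>(2)[of i] first by simp
          next
            case 4
            then show ?thesis using \<beta>(2)[of i] i last by simp
          qed simp_all
        qed
      next
        case few: False
        \<comment> \<open>Three colours on the path: one of \<open>c 0\<close>, \<open>c L\<close> on \<open>W\<close> is enough.\<close>
        have cov: "c i \<in> {c 0, c L, c (\<alpha> + 1)}" if i: "i \<le> L" for i
        proof -
          consider "i \<le> \<alpha>" | "i = \<alpha> + 1" | "i = \<alpha> + 2" "i < \<beta>" | "\<beta> \<le> i"
            using \<beta>3 by linarith
          then show ?thesis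
          proof cases
            case 1
            then show ?thesis using \<alpha>(2)[of i] by simp
          next
            case 3
            then have "c (\<alpha> + 1) = c (\<alpha> + 2)" using few \<beta>3 by auto
            then show ?thesis using 3 by simp
          next
            case 4
            then show ?thesis using \<beta>(2)[of i] i by simp
          qed simp
        qed
        have "c 0 \<in> c ` W \<or> c L \<in> c ` W"
        proof (cases "1 \<le> \<alpha>")
          case True
          then obtain w where w: "w \<in> W" "\<And>i. i \<le> L \<Longrightarrow> i < \<alpha> - 1 \<or> \<alpha> + 2 < i \<Longrightarrow> c i = c w"
            using nearleft by blast
          have "0 < \<alpha> - 1 \<or> \<alpha> + 2 < L" using True L by auto
          then show ?thesis using w(1) w(2)[of 0] w(2)[of L] by auto
        next
          case False
          then have "\<beta> + 1 \<le> L" using \<beta>3 L by simp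
          then obtain w where w: "w \<in> W" "\<And>i. i \<le> L \<Longrightarrow> i < \<beta> - 2 \<or> \<beta> + 1 < i \<Longrightarrow> c i = c w"
            using nearright by blast
          have "0 < \<beta> - 2 \<or> \<beta> + 1 < L" using False \<beta>3 L lt by auto
          then show ?thesis using w(1) w(2)[of 0] w(2)[of L] by auto
        qed
        then show ?thesis
        proof
          assume "c 0 \<in> c ` W"
          then show ?thesis using cov by (intro bound[of "c L" "c (\<alpha> + 1)"]) fastforce
        next
          assume "c L \<in> c ` W"
          then show ?thesis using cov by (intro bound[of "c 0" "c (\<alpha> + 1)"]) fastforce
        qed
      qed
    qed
  qed
  then show ?thesis using G cE by (intro exI[of _ "{0..<n}"] exI[of _ E]) simp
qed

section \<open>The lower bound and its sharpness\<close>

lemma mvc_ge_of_many_edges: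
  assumes G: "connected_graph V E" and t: "t + 2 \<le> card V"
    and m: "card V + (t choose 2) \<le> card E"
  shows "t + 2 \<le> mvc V E"
proof (cases "t + 3 \<le> card V")
  case True
  obtain D where "connected_set E D" "D \<subseteq> V" "t + 1 \<le> card (boundary V E D)"
    using exists_large_boundary[OF G True m] by blast
  then show ?thesis using mvc_gt_card_boundary[OF G] by fastforce
next
  case False
  then have "card V = t + 2" using t by simp
  then show ?thesis using mvc_ge_card_of_dense[OF G] m by simp
qed

theorem theorem3p6:
  fixes n t m :: nat
  assumes "n \<ge> 3"
    and "1 \<le> t" and "t \<le> n - 2"
    and "n + (t choose 2) \<le> m" and "m \<le> n + ((t + 1) choose 2) - 1"
  shows
    "(\<forall>(V :: 'a set) E. connected_graph V E \<and> card V = n \<and> card E = m \<longrightarrow> mvc V E \<ge> t + 2)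
   \<and> (\<not> (m = n + ((t + 1) choose 2) - 1 \<and> t \<in> {n - 3, n - 4}) \<longrightarrow>
        (\<exists>(V :: nat set) E. connected_graph V E \<and> card V = n \<and> card E = m \<and> mvc V E = t + 2))
   \<and> (m = n + ((t + 1) choose 2) - 1 \<and> t \<in> {n - 3, n - 4} \<longrightarrow>
        (\<forall>(V :: 'a set) E. connected_graph V E \<and> card V = n \<and> card E = m \<longrightarrow> mvc V E \<ge> t + 3)
      \<and> (\<exists>(V :: nat set) E. connected_graph V E \<and> card V = n \<and> card E = m \<and> mvc V E = t + 3))"
proof (intro conjI impI)
  have tn: "t + 2 \<le> n" using assms by linarith
  have lower: "t + 2 \<le> mvc V E" if "connected_graph V E" "card V = n" "card E = m"
    for V :: "'b set" and E
    using mvc_ge_of_many_edges[of V E t] that tn assms by simp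
  have lower_exceptional: "t + 3 \<le> mvc V E"
    if "connected_graph V E" "card V = n" "card E = m"
      and exc: "m = n + ((t + 1) choose 2) - 1 \<and> t \<in> {n - 3, n - 4}"
    for V :: "'b set" and E
  proof -
    have m: "n + ((t + 1) choose 2) = m + 1" using exc assms by linarith
    consider "n = t + 3" | "n = t + 4" using exc assms by auto
    then show ?thesis
    proof cases
      case 1
      then show ?thesis using mvc_ge_card_of_dense[of V E] that m by simp
    next
      case 2
      then show ?thesis using mvc_ge_card_minus_one_of_dense[of V E] that m by simp
    qed
  qed
  have upper: "m \<le> n choose 2" if "n = t + 2 \<or> n = t + 3"
  proof -
    have "(t + 2) choose 2 = (t + 1) + ((t + 1) choose 2)"
      "(t + 3) choose 2 = (t + 2) + ((t + 2) choose 2)"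
      by (simp_all add: numeral_2_eq_2 numeral_3_eq_3)
    then show ?thesis using that assms by auto
  qed
  show "\<forall>(V :: 'a set) E. connected_graph V E \<and> card V = n \<and> card E = m \<longrightarrow> mvc V E \<ge> t + 2"
    using lower by blast
  show "\<exists>(V :: nat set) E. connected_graph V E \<and> card V = n \<and> card E = m \<and> mvc V E = t + 2"
    if reg: "\<not> (m = n + ((t + 1) choose 2) - 1 \<and> t \<in> {n - 3, n - 4})"
  proof -
    consider "n = t + 2" | "t + 3 \<le> n" "m + 2 \<le> n + ((t + 1) choose 2)"
      | "t + 5 \<le> n" "m + 1 = n + ((t + 1) choose 2)"
      using reg tn assms by fastforce
    then have "\<exists>(V :: nat set) E. connected_graph V E \<and> card V = n \<and> card E = m \<and> mvc V E \<le> t + 2"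
    proof cases
      case 1
      then obtain V :: "nat set" and E where "connected_graph V E" "card V = n" "card E = m"
        using exists_connected_graph[of n m] upper assms by auto
      then show ?thesis using mvc_le_card[of V E] 1 by (intro exI[of _ V] exI[of _ E]) simp
    next
      case 2
      then show ?thesis using exists_layered_graph[of t n m] assms by simp
    next
      case 3
      then obtain V :: "nat set" and E where "connected_graph V E" "card V = n"
        "card E + 1 = n + ((t + 1) choose 2)" "mvc V E \<le> t + 2"
        using exists_subdivided_clique[of t n] assms by blast
      then show ?thesis using 3 by (intro exI[of _ V] exI[of _ E]) simp
    qed
    then show ?thesis using lower by (metis le_antisym)
  qed
  assume exc: "m = n + ((t + 1) choose 2) - 1 \<and> t \<in> {n - 3, n - 4}"
  show "\<forall>(V :: 'a set) E. connected_graph V E \<and> card V = n \<and> card E = m \<longrightarrow> mvc V E \<ge> t + 3"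
    using lower_exceptional exc by blast
  consider "n = t + 3" | "n = t + 4" using exc assms by auto
  then have "\<exists>(V :: nat set) E. connected_graph V E \<and> card V = n \<and> card E = m \<and> mvc V E \<le> t + 3"
  proof cases
    case 1
    then obtain V :: "nat set" and E where "connected_graph V E" "card V = n" "card E = m"
      using exists_connected_graph[of n m] upper assms by auto
    then show ?thesis using mvc_le_card[of V E] 1 by (intro exI[of _ V] exI[of _ E]) simp
  next
    case 2
    \<comment> \<open>The layered graph of the next value of \<open>t\<close> has few enough colours and still room for \<open>m\<close> edges.\<close>
    have "(t + 2) choose 2 = (t + 1) + ((t + 1) choose 2)" by (simp add: numeral_2_eq_2)
    then show ?thesis using exists_layered_graph[of "t + 1" n m] assms 2 exc by (simp add: numeral_3_eq_3)
  qed
  then show "\<exists>(V :: nat set) E. connected_graph V E \<and> card V = n \<and> card E = m \<and> mvc V E = t + 3"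
    using lower_exceptional exc by (metis le_antisym)
qed

end
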